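(* Let $D=(\alpha_1(D),\dots,\alpha_\ell(D))\notin\mathfrak B$ be a connected ribbon with an odd number of boxes, odd length $\ell$, and $\alpha_1(D)=1$. Let $k$ and $m$ be the head length and tail length of $D$. Then $\mathfrak r_D$ is not $p$-positive in each of the following cases: (a) $\alpha_\ell(D)>1$ and $k$ is even; (b) $\alpha_\ell(D)>1$, $k$ is odd and $m$ is even; (c) $\alpha_\ell(D)=1$ and $k=m$.
   Context: A connected ribbon $D$ of composition $(\alpha_1(D),\dots,\alpha_\ell(D))$ has $\alpha_r(D)$ consecutive boxes in row $r$ (rows numbered top to bottom), with the leftmost box of row $r$ directly above the rightmost box of row $r+1$; $\ell$ is its length. The head length of $D$ is the smallest index $i$ such that row $i$ contains at least two boxes. The tail length of $D$ is: if $\alpha_\ell(D)=1$, the smallest $j$ such that row $\ell-j+1$ contains at least two boxes; otherwise $\alpha_\ell(D)$. $D^t$ is the transpose and $D^\circ$ the rotation by 180 degrees. $\mathfrak r_D=\sum_T x^{c(T)}$ over fillings $T$ of $D$ with letters of $\{1'<1<2'<2<\cdots\}$ having rows and columns weakly increasing, at most one unmarked $k$ per column and at most one marked $k'$ per row; $c(T)_i$ counts entries $i$ or $i'$. $\triangle_{n,k}$ is the ribbon of composition $(1^{k-1},n-k+1)$; $\mathfrak B=\bigcup_n\mathfrak B_n$ with $\mathfrak B_n=\{\triangle_{n,1},\triangle_{n,1}^t,\triangle_{n,3},\triangle_{n,3}^t,\triangle_{n,3}^\circ,(\triangle_{n,3}^t)^\circ\}$ (only the first two when $n\le 2$). A symmetric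 function is $p$-positive if all its coefficients in the power sum basis are nonnegative. *)

theory Defs
  imports Complex_Main "HOL-Library.FuncSet"
begin

text \<open>A connected ribbon is encoded by its composition
  alpha = [alpha_1, ..., alpha_l] (a nonempty list of positive naturals);
  alpha ! (r-1) is the number of boxes in row r (rows numbered top to bottom).\<close>

definition is_ribbon :: "nat list \<Rightarrow> bool" where
  "is_ribbon \<alpha> \<longleftrightarrow> \<alpha> \<noteq> [] \<and> (\<forall>x\<in>set \<alpha>. 0 < x)"

text \<open>Starting column of row r (1-indexed). The bottom row starts in column 0 and the
  leftmost box of row r lies directly above the rightmost box of row r+1.\<close>
definition row_start :: "nat list \<Rightarrow> nat \<Rightarrow> nat" where
  "row_start \<alpha> r = sum_list (map (%x. x - 1) (drop r \<alpha>))"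

text \<open>Boxes (row, column), English convention: rows increase downward,
  columns increase to the right.\<close>
definition ribbon_boxes :: "nat list \<Rightarrow> (nat \<times> nat) set" where
  "ribbon_boxes \<alpha> = {(r, c). 1 \<le> r \<and> r \<le> length \<alpha> \<and>
       row_start \<alpha> r \<le> c \<and> c < row_start \<alpha> r + \<alpha> ! (r - 1)}"

text \<open>Letters of the alphabet 1' < 1 < 2' < 2 < ... are encoded by positive naturals:
  the marked letter k' is 2k-1 (odd) and the unmarked letter k is 2k (even), so the
  order of the alphabet is the order on nat.  The underlying value of a letter v is
  (v+1) div 2.\<close>

definition valid_filling :: "nat list \<Rightarrow> (nat \<times> nat \<Rightarrow> nat) \<Rightarrow> bool" where
  "valid_filling \<alpha> T \<longleftrightarrow>
     T \<in> ribbon_boxes \<alpha> \<rightarrow>\<^sub>E {1..} \<and>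
     (\<forall>r c r' c'. (r, c) \<in> ribbon_boxes \<alpha> \<longrightarrow> (r', c') \<in> ribbon_boxes \<alpha> \<longrightarrow>
        (r = r' \<and> c \<le> c' \<longrightarrow> T (r, c) \<le> T (r', c')) \<and>
        (c = c' \<and> r \<le> r' \<longrightarrow> T (r, c) \<le> T (r', c')) \<and>
        (c = c' \<and> r \<noteq> r' \<and> even (T (r, c)) \<longrightarrow> T (r, c) \<noteq> T (r', c')) \<and>
        (r = r' \<and> c \<noteq> c' \<and> odd (T (r, c)) \<longrightarrow> T (r, c) \<noteq> T (r', c')))"

definition content :: "nat list \<Rightarrow> (nat \<times> nat \<Rightarrow> nat) \<Rightarrow> nat \<Rightarrow> nat" where
  "content \<alpha> T i = card {b \<in> ribbon_boxes \<alpha>. (T b + 1) div 2 = i}"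

text \<open>A formal power series in the variables x_1, x_2, ... is represented by its
  coefficient function on exponent vectors a :: nat \<Rightarrow> nat (a i = exponent of x_i).
  The coefficient of x^a in r_D is the number of valid fillings of content a.\<close>
definition ribbon_fn :: "nat list \<Rightarrow> (nat \<Rightarrow> nat) \<Rightarrow> real" where
  "ribbon_fn \<alpha> a = real (card {T. valid_filling \<alpha> T \<and> (\<forall>i. content \<alpha> T i = a i)})"

definition partitions :: "nat \<Rightarrow> nat list set" where
  "partitions n = {lam. sorted_wrt (\<ge>) lam \<and> (\<forall>x\<in>set lam. 0 < x) \<and> sum_list lam = n}"

text \<open>Coefficient of x^a in the power sum p_lambda = prod_i (sum_{j>=1} x_j^{lambda_i}).\<close>
definition psum_coeff :: "nat list \<Rightarrow> (nat \<Rightarrow> nat) \<Rightarrow> nat" where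
  "psum_coeff lam a = card {js. length js = length lam \<and> (\<forall>j\<in>set js. 1 \<le> j) \<and>
       (\<forall>j. a j = (\<Sum>i<length lam. if js ! i = j then lam ! i else 0))}"

text \<open>p-positivity: f = sum over partitions lambda of c_lambda p_lambda with all c_lambda \<ge> 0
  (compared coefficientwise on all monomials x^a; a monomial of degree d only receives
  contributions from partitions of d).\<close>
definition p_positive :: "((nat \<Rightarrow> nat) \<Rightarrow> real) \<Rightarrow> bool" where
  "p_positive f \<longleftrightarrow> (\<exists>c :: nat list \<Rightarrow> real. (\<forall>lam. c lam \<ge> 0) \<and>
     (\<forall>a. finite {i. a i \<noteq> 0} \<longrightarrow>
        f a = (\<Sum>lam\<in>partitions (\<Sum>i\<in>{i. a i \<noteq> 0}. a i). c lam * real (psum_coeff lam a))))"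

definition head_len :: "nat list \<Rightarrow> nat" where
  "head_len \<alpha> = (LEAST i. 1 \<le> i \<and> i \<le> length \<alpha> \<and> 2 \<le> \<alpha> ! (i - 1))"

definition tail_len :: "nat list \<Rightarrow> nat" where
  "tail_len \<alpha> = (if last \<alpha> = 1
     then (LEAST j. 1 \<le> j \<and> j \<le> length \<alpha> \<and> 2 \<le> \<alpha> ! (length \<alpha> - j))
     else last \<alpha>)"

fun diffs :: "nat \<Rightarrow> nat list \<Rightarrow> nat list" where
  "diffs p [] = []"
| "diffs p (x # xs) = (x - p) # diffs x xs"

definition comp_of_set :: "nat \<Rightarrow> nat set \<Rightarrow> nat list" where
  "comp_of_set n S = diffs 0 (sorted_list_of_set (insert n S))"

definition descents :: "nat list \<Rightarrow> nat set" where
  "descents \<alpha> = {sum_list (take i \<alpha>) | i. 1 \<le> i \<and> i < length \<alpha>}"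

definition ribbon_transpose :: "nat list \<Rightarrow> nat list" where
  "ribbon_transpose \<alpha> =
     rev (comp_of_set (sum_list \<alpha>) ({1..<sum_list \<alpha>} - descents \<alpha>))"

definition ribbon_rot :: "nat list \<Rightarrow> nat list" where
  "ribbon_rot \<alpha> = rev \<alpha>"

definition tri :: "nat \<Rightarrow> nat \<Rightarrow> nat list" where
  "tri n k = replicate (k - 1) 1 @ [n - k + 1]"

definition ribbonB_n :: "nat \<Rightarrow> nat list set" where
  "ribbonB_n n = (if n \<le> 2 then {tri n 1, ribbon_transpose (tri n 1)}
     else {tri n 1, ribbon_transpose (tri n 1), tri n 3, ribbon_transpose (tri n 3),
           ribbon_rot (tri n 3), ribbon_rot (ribbon_transpose (tri n 3))})"

definition ribbonB :: "nat list set" where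
  "ribbonB = (\<Union>n\<in>{1..}. ribbonB_n n)"

end

theory Submission
  imports Defs "HOL-Computational_Algebra.Computational_Algebra" "HOL-Library.Nonpos_Ints"
begin

text \<open>The coefficient of p_(a,b,c) in the ribbon function, for odd a, b, c with a + b + c = n, is a
  positive multiple of the alternating sum over the ordered set partitions of {a, b, c} whose partial
  sums are row ends of the ribbon. When the number of rows is odd this is
  (1 - A) (1 - B) - C, where A and B count the x in {a, b, c} such that x, respectively n - x, is a
  row end, and C counts those for which both are. With head length k and tail length m it is negative for
  (1, k-1, n-k) in case (a) and in case (c) with k even, for (1, m-1, n-m) in case (b), and for
  (1, k, n-k-1) in case (c) with k odd.

  To extract this coefficient without inverting the transition between power sums and monomials, evaluate
  on the alphabet of all e1 z, e2 z, e3 z where z runs over the roots of unity of order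
  a, b, c respectively. Each power sum becomes a polynomial with nonnegative coefficients in
  u = e1^a, v = e2^b, w = e3^c, so for a p-positive function the coefficient of u v w is nonnegative.
  The generating function of one-row ribbons becomes the product of (1 + u X^a) / (1 - u X^a) and its two
  analogues, and a ribbon is reduced to rows by splitting it at a row end.\<close>

section \<open>Polynomials in three variables\<close>

text \<open>The outermost polynomial layer is the variable u, the middle one v and the innermost one
  w, so \<open>[:0, 1:]\<close>, \<open>[:[:0, 1:]:]\<close> and \<open>[:[:[:0, 1:]:]:]\<close> are
  the three variables.\<close>

definition eval3 :: "'a::comm_ring_1 poly poly poly \<Rightarrow> 'a \<Rightarrow> 'a \<Rightarrow> 'a \<Rightarrow> 'a" where
  "eval3 P u v w = poly (poly (poly P [:[:u:]:]) [:v:]) w"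

definition coeff3 :: "'a::comm_ring_1 poly poly poly \<Rightarrow> nat \<Rightarrow> nat \<Rightarrow> nat \<Rightarrow> 'a" where
  "coeff3 P i j k = coeff (coeff (coeff P i) j) k"

lemma eval3_simps [simp]:
  "eval3 0 u v w = 0" "eval3 1 u v w = 1" "eval3 (numeral r) u v w = numeral r"
  "eval3 (P + Q) u v w = eval3 P u v w + eval3 Q u v w"
  "eval3 (P - Q) u v w = eval3 P u v w - eval3 Q u v w"
  "eval3 (P * Q) u v w = eval3 P u v w * eval3 Q u v w"
  "eval3 (P ^ m) u v w = eval3 P u v w ^ m"
  "eval3 [:0, 1:] u v w = u" "eval3 [:[:0, 1:]:] u v w = v" "eval3 [:[:[:0, 1:]:]:] u v w = w"
  "eval3 [:[:[:z:]:]:] u v w = z"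
  by (simp_all add: eval3_def)

lemma eval3_sum: "eval3 (sum F A) u v w = (\<Sum>i\<in>A. eval3 (F i) u v w)"
  by (simp add: eval3_def poly_sum)

lemma eval3_prod_list: "eval3 (prod_list Ps) u v w = prod_list (map (\<lambda>P. eval3 P u v w) Ps)"
  by (induction Ps) auto

text \<open>A nonzero polynomial over an integral domain has finitely many roots; this is applied to
  the difference one variable at a time, from w outwards to u.\<close>

lemma eval3_eq_imp_eq:
  fixes P Q :: "'a::idom poly poly poly"
  assumes inf: "infinite U" "infinite V" "infinite W"
    and eq: "\<And>u v w. u \<in> U \<Longrightarrow> v \<in> V \<Longrightarrow> w \<in> W \<Longrightarrow> eval3 P u v w = eval3 Q u v w"
  shows "P = Q"
proof -
  \<comment> \<open>The sample points of the outer layers are constant polynomials, so the infinite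
    set enters through an injection \<open>f\<close>.\<close>
  have zero: "p = 0" if "infinite A" "inj_on f A" "\<And>x. x \<in> A \<Longrightarrow> poly p (f x) = 0"
    for p :: "'b::idom poly" and f :: "'c \<Rightarrow> 'b" and A
  proof (rule ccontr)
    assume "p \<noteq> 0"
    then have "finite {x. poly p x = 0}"
      by (rule poly_roots_finite)
    moreover have "f ` A \<subseteq> {x. poly p x = 0}"
      using that(3) by auto
    ultimately show False
      using that(1,2) finite_imageD finite_subset by blast
  qed
  define T where "T = P - Q"
  have T: "poly (poly (poly T [:[:u:]:]) [:v:]) w = 0" if "u \<in> U" "v \<in> V" "w \<in> W" for u v w
    using eq[OF that] by (simp add: T_def eval3_def)
  have "poly (poly T [:[:u:]:]) [:v:] = 0" if "u \<in> U" "v \<in> V" for u v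
    by (rule zero[OF inf(3), of "\<lambda>x. x"]) (use T that in auto)
  then have "poly T [:[:u:]:] = 0" if "u \<in> U" for u
    by (intro zero[OF inf(2), of "\<lambda>v. [:v:]"]) (use that in \<open>auto simp: inj_on_def\<close>)
  then have "T = 0"
    by (intro zero[OF inf(1), of "\<lambda>u. [:[:u:]:]"]) (auto simp: inj_on_def)
  then show ?thesis
    by (simp add: T_def)
qed

lemma coeff_mult_1: "coeff (p * q) (Suc 0) = coeff p 0 * coeff q (Suc 0) + coeff p (Suc 0) * coeff q 0"
  by (simp add: coeff_mult)

text \<open>Multiplication modulo u^2, v^2 and w^2: exponents at most 1 only receive contributions
  from such exponents, so these eight coefficients are closed under products.\<close>

lemma coeff3_mult:
  "coeff3 (P * Q) 0 0 0 = coeff3 P 0 0 0 * coeff3 Q 0 0 0"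
  "coeff3 (P * Q) 1 0 0 = coeff3 P 0 0 0 * coeff3 Q 1 0 0 + coeff3 P 1 0 0 * coeff3 Q 0 0 0"
  "coeff3 (P * Q) 0 1 0 = coeff3 P 0 0 0 * coeff3 Q 0 1 0 + coeff3 P 0 1 0 * coeff3 Q 0 0 0"
  "coeff3 (P * Q) 0 0 1 = coeff3 P 0 0 0 * coeff3 Q 0 0 1 + coeff3 P 0 0 1 * coeff3 Q 0 0 0"
  "coeff3 (P * Q) 1 1 0 = coeff3 P 0 0 0 * coeff3 Q 1 1 0 + coeff3 P 1 0 0 * coeff3 Q 0 1 0
     + coeff3 P 0 1 0 * coeff3 Q 1 0 0 + coeff3 P 1 1 0 * coeff3 Q 0 0 0"
  "coeff3 (P * Q) 1 0 1 = coeff3 P 0 0 0 * coeff3 Q 1 0 1 + coeff3 P 1 0 0 * coeff3 Q 0 0 1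
     + coeff3 P 0 0 1 * coeff3 Q 1 0 0 + coeff3 P 1 0 1 * coeff3 Q 0 0 0"
  "coeff3 (P * Q) 0 1 1 = coeff3 P 0 0 0 * coeff3 Q 0 1 1 + coeff3 P 0 1 0 * coeff3 Q 0 0 1
     + coeff3 P 0 0 1 * coeff3 Q 0 1 0 + coeff3 P 0 1 1 * coeff3 Q 0 0 0"
  "coeff3 (P * Q) 1 1 1 = coeff3 P 0 0 0 * coeff3 Q 1 1 1 + coeff3 P 1 0 0 * coeff3 Q 0 1 1
     + coeff3 P 0 1 0 * coeff3 Q 1 0 1 + coeff3 P 0 0 1 * coeff3 Q 1 1 0
     + coeff3 P 1 1 0 * coeff3 Q 0 0 1 + coeff3 P 1 0 1 * coeff3 Q 0 1 0
     + coeff3 P 0 1 1 * coeff3 Q 1 0 0 + coeff3 P 1 1 1 * coeff3 Q 0 0 0"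
  by (simp_all add: coeff3_def coeff_mult_1 coeff_mult_0)

lemma coeff3_diff: "coeff3 (P - Q) i j k = coeff3 P i j k - coeff3 Q i j k"
  by (simp add: coeff3_def)

lemma coeff3_sum: "coeff3 (sum F A) i j k = (\<Sum>l\<in>A. coeff3 (F l) i j k)"
  by (simp add: coeff3_def coeff_sum)

text \<open>The coefficients of (1 + u X^a) / (1 - u X^a).\<close>

definition qcoef1 :: "nat \<Rightarrow> 'a::comm_ring_1 \<Rightarrow> nat \<Rightarrow> 'a" where
  "qcoef1 a u i = (if i = 0 then 1 else if a dvd i then 2 * u ^ (i div a) else 0)"

definition qcoef3 :: "nat \<Rightarrow> nat \<Rightarrow> nat \<Rightarrow> 'a::comm_ring_1 \<Rightarrow> 'a \<Rightarrow> 'a \<Rightarrow> nat \<Rightarrow> 'a" where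
  "qcoef3 a b c u v w i =
     (Abs_fps (qcoef1 a u) * Abs_fps (qcoef1 b v) * Abs_fps (qcoef1 c w)) $ i"

lemma qcoef1_fps:
  assumes "a > 0"
  shows "Abs_fps (qcoef1 a u) * (1 - fps_const u * fps_X ^ a) = 1 + fps_const u * fps_X ^ a"
proof (rule fps_ext)
  fix n
  have 1: "(Abs_fps (qcoef1 a u) * (1 - fps_const u * fps_X ^ a)) $ n =
      qcoef1 a u n - u * (if n < a then 0 else qcoef1 a u (n - a))"
  proof -
    have "Abs_fps (qcoef1 a u) * (1 - fps_const u * fps_X ^ a) =
        Abs_fps (qcoef1 a u) - fps_const u * (Abs_fps (qcoef1 a u) * fps_X ^ a)"
      by (simp only: right_diff_distrib mult.left_commute mult_1_right)
    then show ?thesis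
      by (simp add: fps_X_power_mult_right_nth)
  qed
  \<comment> \<open>\<open>n = a\<close> stands apart because the constant coefficient is 1 and not
    2: there the difference is 2u - u = u, while at larger multiples of a two equal terms
    cancel.\<close>
  have 2: "n = a \<or> (n div a = Suc ((n - a) div a))" if "\<not> n < a"
    using that assms by (simp add: le_div_geq)
  show "(Abs_fps (qcoef1 a u) * (1 - fps_const u * fps_X ^ a)) $ n =
      (1 + fps_const u * fps_X ^ a) $ n"
    unfolding 1 using assms 2
    by (auto simp: qcoef1_def fps_X_power_nth dvd_minus_self not_less nat_dvd_not_less)
qed

lemma eval3_qcoef1: "eval3 (qcoef1 a U i) u v w = qcoef1 a (eval3 U u v w) i"
  by (simp add: qcoef1_def)

lemma eval3_qcoef3: "eval3 (qcoef3 a b c U V W i) u v w =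
    qcoef3 a b c (eval3 U u v w) (eval3 V u v w) (eval3 W u v w) i"
  by (simp add: qcoef3_def fps_mult_nth eval3_sum eval3_qcoef1)

abbreviation qpoly3 :: "nat \<Rightarrow> nat \<Rightarrow> nat \<Rightarrow> nat \<Rightarrow> 'a::comm_ring_1 poly poly poly" where
  "qpoly3 a b c \<equiv> qcoef3 a b c [:0, 1:] [:[:0, 1:]:] [:[:[:0, 1:]:]:]"

lemma X_power_eq_monom: "[:0, 1:] ^ m = monom (1::'a::comm_ring_1) m"
  by (simp add: monom_altdef)

lemma qcoef1_alt: "qcoef1 a u i = (if i = 0 then 1 else if a dvd i then u ^ (i div a) + u ^ (i div a) else 0)"
  by (simp only: qcoef1_def mult_2)

lemma const_poly_power: "[:p:] ^ m = [:p ^ m:]"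
  by (induction m) (auto simp: one_pCons mult.commute)

lemma coeff3_var_power:
  "coeff3 ([:0, 1:] ^ m) x y z = of_bool (x = m \<and> y = 0 \<and> z = 0)"
  "coeff3 ([:[:0, 1:]:] ^ m) x y z = of_bool (y = m \<and> x = 0 \<and> z = 0)"
  "coeff3 ([:[:[:0, 1:]:]:] ^ m) x y z = of_bool (z = m \<and> x = 0 \<and> y = 0)"
  unfolding const_poly_power X_power_eq_monom coeff3_def coeff_monom
  by (cases x; cases y; cases z; simp add: coeff_1)+

text \<open>Up to degree one in its variable, (1 + u X^a) / (1 - u X^a) is 1 + 2 u X^a, and both
  terms have the shape 2^x u^x X^(a x).\<close>

lemma coeff3_qcoef1:
  fixes i :: nat
  assumes "x \<le> 1" "y \<le> 1" "z \<le> 1" "a > 0"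
  shows "coeff3 (qcoef1 a [:0, 1:] i) x y z = (if i = a * x \<and> y = 0 \<and> z = 0 then 2 ^ x else (0 :: 'a::comm_ring_1))" (is ?A)
    and "coeff3 (qcoef1 a [:[:0, 1:]:] i) x y z = (if i = a * y \<and> x = 0 \<and> z = 0 then 2 ^ y else (0 :: 'a))" (is ?B)
    and "coeff3 (qcoef1 a [:[:[:0, 1:]:]:] i) x y z = (if i = a * z \<and> x = 0 \<and> y = 0 then 2 ^ z else (0 :: 'a))" (is ?C)
proof -
  have xyz: "x = 0 \<or> x = 1" "y = 0 \<or> y = 1" "z = 0 \<or> z = 1"
    using assms by auto
  have add: "coeff3 (P + Q) x y z = coeff3 P x y z + coeff3 Q x y z"
    for P Q :: "'a poly poly poly"
    by (simp add: coeff3_def)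
  have one: "coeff3 1 x y z = of_bool (x = 0 \<and> y = 0 \<and> z = 0)"
    using coeff3_var_power(1)[of 0 x y z] by auto
  have zero: "coeff3 0 x y z = 0"
    by (simp add: coeff3_def)
  consider "i = 0" | m where "i = a * m" "m > 0" | "i \<noteq> 0" "\<not> a dvd i"
    using assms(4) by (metis dvdE gr0I mult_0_right)
  then have "?A \<and> ?B \<and> ?C"
  proof cases
    case 1
    then show ?thesis
      using assms(4) xyz by (auto simp: qcoef1_alt one)
  next
    case 2
    then have q: "qcoef1 a u i = u ^ m + u ^ m" for u :: "'a poly poly poly"
      using assms(4) by (simp add: qcoef1_alt)
    show ?thesis
      unfolding q add coeff3_var_power using assms(4) xyz 2 by auto
  next
    case 3
    then show ?thesis
      using assms(4) xyz by (auto simp: qcoef1_alt zero)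
  qed
  then show ?A ?B ?C
    by blast+
qed

lemma coeff3_triple_mult:
  fixes a b c :: nat
  assumes "a > 0" "b > 0" "c > 0" "x \<le> 1" "y \<le> 1" "z \<le> 1"
  shows "coeff3 (qcoef1 a [:0, 1:] l * qcoef1 b [:[:0, 1:]:] m * qcoef1 c [:[:[:0, 1:]:]:] r) x y z =
    (if l = a * x then 2 ^ x else 0) * (if m = b * y then 2 ^ y else 0) *
    (if r = c * z then 2 ^ z else (0 :: 'a::comm_ring_1))"
proof -
  have "x = 0 \<or> x = 1" "y = 0 \<or> y = 1" "z = 0 \<or> z = 1"
    using assms by auto
  then show ?thesis
    using assms by (elim disjE) (simp_all only: coeff3_mult, simp_all add: coeff3_qcoef1)
qed

lemma coeff3_qpoly3:
  fixes a b c :: nat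
  assumes "a > 0" "b > 0" "c > 0" "x \<le> 1" "y \<le> 1" "z \<le> 1"
  shows "coeff3 (qpoly3 a b c i) x y z =
    (if i = a * x + b * y + c * z then 2 ^ (x + y + z) else (0 :: 'a::comm_ring_1))"
proof -
  \<comment> \<open>Each factor involves its own variable only, so extracting the coefficient of u^x
    v^y w^z commutes with the Cauchy product and leaves one monomial \<open>F\<close> per
    factor.\<close>
  define F :: "nat \<Rightarrow> nat \<Rightarrow> 'a fps" where "F = (\<lambda>A x. Abs_fps (\<lambda>l. if l = A * x then 2 ^ x else 0))"
  have F: "F A x = fps_const (2 ^ x) * fps_X ^ (A * x)" for A x
    by (rule fps_ext) (simp add: F_def)
  have "coeff3 (qpoly3 a b c i) x y z = (F a x * F b y * F c z) $ i"
    by (simp add: qcoef3_def fps_mult_nth coeff3_sum sum_distrib_right coeff3_triple_mult[OF assms] F_def)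
  also have "F a x * F b y * F c z = fps_const (2 ^ (x + y + z)) * fps_X ^ (a * x + b * y + c * z)"
    unfolding F by (simp add: power_add algebra_simps flip: fps_const_mult)
  finally show ?thesis
    by simp
qed

section \<open>Alphabets of roots of unity and ribbon words\<close>

lemma prod_unity_roots:
  fixes t :: complex
  assumes "n > 0"
  shows "(\<Prod>z\<in>{z. z ^ n = 1}. 1 - z * t) = 1 - t ^ n"
proof -
  define R where "R = {z::complex. z ^ n = 1}"
  have R: "finite R" "card R = n"
    using assms by (simp_all add: R_def finite_roots_unity card_roots_unity_eq)
  have "0 \<notin> R"
    using assms by (simp add: R_def power_0_left)
  define p where "p = (\<Prod>z\<in>R. [:1, - z:])"
  define q :: "complex poly" where "q = 1 - monom 1 n"
  have "p = q"
  \<comment> \<open>Both sides have degree at most n, so the n roots together with 0 are enough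
    points. At a root x the factor for z = 1/x vanishes.\<close>
  proof (rule poly_eqI_degree[where A = "insert 0 R"])
    fix x
    assume x: "x \<in> insert 0 R"
    show "poly p x = poly q x"
    proof (cases "x = 0")
      case True
      then show ?thesis
        using assms by (simp add: p_def q_def poly_prod poly_monom power_0_left)
    next
      case False
      then have "inverse x \<in> R" "x \<in> R"
        using x by (auto simp: R_def power_inverse)
      then have "poly p x = 0"
        using False R(1) by (auto simp: p_def poly_prod intro!: bexI[of _ "inverse x"])
      then show ?thesis
        using \<open>x \<in> R\<close> by (simp add: q_def poly_monom R_def)
    qed
  next
    have "degree p \<le> (\<Sum>z\<in>R. degree [:1, - z:])"
      unfolding p_def by (rule order_trans[OF degree_prod_sum_le[OF R(1)]]) (simp add: o_def)
    also have "\<dots> \<le> (\<Sum>z\<in>R. 1)"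
      by (intro sum_mono) simp
    finally show "card (insert 0 R) > degree p"
      using R \<open>0 \<notin> R\<close> by simp
    have "degree q \<le> n"
      unfolding q_def by (rule degree_diff_le) (simp_all add: degree_monom_eq)
    then show "card (insert 0 R) > degree q"
      using R \<open>0 \<notin> R\<close> by simp
  qed
  then have "poly p t = poly q t"
    by simp
  then show ?thesis
    by (simp add: p_def q_def R_def poly_prod poly_monom mult.commute)
qed

lemma sum_power_unity_roots:
  assumes "n > 0"
  shows "(\<Sum>z\<in>{z::complex. z ^ n = 1}. z ^ k) = (if n dvd k then of_nat n else 0)"
proof -
  define \<zeta> where "\<zeta> = cis (2 * pi / real n)"
  have \<zeta>: "cis (2 * pi * real j / real n) = \<zeta> ^ j" for j
    by (simp add: \<zeta>_def DeMoivre field_simps)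
  have \<zeta>_n: "\<zeta> ^ n = 1"
    using assms by (simp add: \<zeta>_def DeMoivre)
  have "(\<Sum>z\<in>{z::complex. z ^ n = 1}. z ^ k) = (\<Sum>j<n. (\<zeta> ^ j) ^ k)"
    using sum.reindex_bij_betw[OF bij_betw_roots_unity[OF assms], of "\<lambda>z. z ^ k"] by (simp add: \<zeta>)
  also have "\<dots> = (\<Sum>j<n. (\<zeta> ^ k) ^ j)"
    by (simp add: mult.commute flip: power_mult)
  also have "\<dots> = (if n dvd k then of_nat n else 0)"
  proof (cases "n dvd k")
    case True
    then show ?thesis
      by (auto elim!: dvdE simp: power_mult \<zeta>_n)
  next
    case False
    \<comment> \<open>The powers of zeta with exponent below n are distinct, so zeta^k = 1 would
      force k mod n = 0.\<close>
    have "\<zeta> ^ k \<noteq> 1"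
    proof
      assume "\<zeta> ^ k = 1"
      moreover have "\<zeta> ^ k = \<zeta> ^ (k mod n)"
        by (metis \<zeta>_n div_mult_mod_eq mult_1 power_add power_mult power_one mult.commute)
      ultimately have eq: "cis (2 * pi * real (k mod n) / real n) = cis (2 * pi * real 0 / real n)"
        using \<zeta>[of "k mod n"] by simp
      have inj: "inj_on (\<lambda>k. cis (2 * pi * real k / real n)) {..<n}"
        using bij_betw_roots_unity[OF assms] by (simp add: bij_betw_def)
      have "k mod n = 0"
        by (rule inj_onD[OF inj eq]) (use assms in auto)
      then show False
        using False by auto
    qed
    moreover have "(\<zeta> ^ k) ^ n = 1"
      using \<zeta>_n by (metis mult.commute power_mult power_one)
    ultimately show ?thesis
      using False by (simp add: sum_gp_strict geometric_sum)
  qed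
  finally show ?thesis .
qed

definition alphabet3 :: "nat \<Rightarrow> nat \<Rightarrow> nat \<Rightarrow> complex \<Rightarrow> complex \<Rightarrow> complex \<Rightarrow> nat \<Rightarrow> complex" where
  "alphabet3 a b c e1 e2 e3 j =
    (if j \<le> a then e1 * cis (2 * pi * real (j - 1) / real a)
     else if j \<le> a + b then e2 * cis (2 * pi * real (j - 1 - a) / real b)
     else e3 * cis (2 * pi * real (j - 1 - a - b) / real c))"

context comm_monoid_set
begin

text \<open>Stated for an arbitrary commutative monoid, so that one proof serves both the products
  of the generating function and the sums of the power sums.\<close>

lemma split_three:
  "F g {1..a + b + c} = F (\<lambda>j. g (Suc j)) {..<a} \<^bold>* F (\<lambda>j. g (Suc (a + j))) {..<b} \<^bold>*
     F (\<lambda>j. g (Suc (a + b + j))) {..<c}"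
proof -
  have *: "F g {Suc m..m + n} = F (\<lambda>j. g (Suc (m + j))) {..<n}" for m n
    by (rule reindex_bij_witness[of _ "\<lambda>j. Suc (m + j)" "\<lambda>i. i - Suc m"]) auto
  have "{1..a + b + c} = {Suc 0..0 + a} \<union> ({Suc a..a + b} \<union> {Suc (a + b)..a + b + c})"
    by auto
  then have "F g {1..a + b + c} = F g ({Suc 0..0 + a} \<union> ({Suc a..a + b} \<union> {Suc (a + b)..a + b + c}))"
    by simp
  also have "\<dots> = F g {Suc 0..0 + a} \<^bold>* (F g {Suc a..a + b} \<^bold>* F g {Suc (a + b)..a + b + c})"
    by (subst union_disjoint, auto)+
  finally show ?thesis
    unfolding * by (simp add: assoc)
qed

end

lemma prod_alphabet3:
  fixes f :: "complex \<Rightarrow> 'a::comm_monoid_mult"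
  assumes "a > 0" "b > 0" "c > 0"
  shows "(\<Prod>j=1..a + b + c. f (alphabet3 a b c e1 e2 e3 j)) =
    (\<Prod>z\<in>{z. z ^ a = 1}. f (e1 * z)) * (\<Prod>z\<in>{z. z ^ b = 1}. f (e2 * z)) *
    (\<Prod>z\<in>{z. z ^ c = 1}. f (e3 * z))"
proof -
  have "(\<Prod>j<n. f (e * cis (2 * pi * real j / real n))) = (\<Prod>z\<in>{z. z ^ n = 1}. f (e * z))"
    if "n > 0" for n e
    using prod.reindex_bij_betw[OF bij_betw_roots_unity[OF that], of "\<lambda>z. f (e * z)"] .
  then show ?thesis
    unfolding prod.split_three using assms by (simp add: alphabet3_def)
qed

lemma sum_alphabet3:
  fixes f :: "complex \<Rightarrow> 'a::comm_monoid_add"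
  assumes "a > 0" "b > 0" "c > 0"
  shows "(\<Sum>j=1..a + b + c. f (alphabet3 a b c e1 e2 e3 j)) =
    (\<Sum>z\<in>{z. z ^ a = 1}. f (e1 * z)) + (\<Sum>z\<in>{z. z ^ b = 1}. f (e2 * z)) +
    (\<Sum>z\<in>{z. z ^ c = 1}. f (e3 * z))"
proof -
  have "(\<Sum>j<n. f (e * cis (2 * pi * real j / real n))) = (\<Sum>z\<in>{z. z ^ n = 1}. f (e * z))"
    if "n > 0" for n e
    using sum.reindex_bij_betw[OF bij_betw_roots_unity[OF that], of "\<lambda>z. f (e * z)"] .
  then show ?thesis
    unfolding sum.split_three using assms by (simp add: alphabet3_def)
qed

text \<open>The k-th power sum of e times the a-th roots of unity, as a function of u = e^a.\<close>

definition psum_term :: "nat \<Rightarrow> 'a::comm_ring_1 \<Rightarrow> nat \<Rightarrow> 'a" where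
  "psum_term a u k = (if a dvd k then of_nat a * u ^ (k div a) else 0)"

lemma psum_alphabet3:
  assumes "a > 0" "b > 0" "c > 0"
  shows "(\<Sum>j=1..a + b + c. alphabet3 a b c e1 e2 e3 j ^ k) =
    psum_term a (e1 ^ a) k + psum_term b (e2 ^ b) k + psum_term c (e3 ^ c) k"
proof -
  have "(\<Sum>z\<in>{z. z ^ n = 1}. (e * z) ^ k) = psum_term n (e ^ n) k"
    if "n > 0" for n and e :: complex
    using that by (auto simp: power_mult_distrib psum_term_def sum_power_unity_roots
      simp flip: sum_distrib_left power_mult)
  then show ?thesis
    using assms unfolding sum_alphabet3[OF assms, of "\<lambda>z. z ^ k"] by simp
qed

text \<open>row_le x y says that y may follow x immediately to the right in a row. Its negation
  says that y may stand immediately above x in a column.\<close>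

definition row_le :: "nat \<Rightarrow> nat \<Rightarrow> bool" where
  "row_le x y \<longleftrightarrow> x < y \<or> x = y \<and> even x"

text \<open>Words that read a ribbon with row ends D, one letter per box. A bound m = 2 N means N
  variables; an odd m lacks the unmarked letter of the last variable and occurs when letters are
  added one by one.\<close>

definition dwords :: "nat \<Rightarrow> nat \<Rightarrow> nat set \<Rightarrow> nat list set" where
  "dwords m n D = {w. length w = n \<and> set w \<subseteq> {1..m} \<and>
     (\<forall>i. Suc i < n \<longrightarrow> (row_le (w ! i) (w ! Suc i) \<longleftrightarrow> Suc i \<notin> D))}"

definition word_weight :: "(nat \<Rightarrow> 'a::comm_ring_1) \<Rightarrow> nat list \<Rightarrow> 'a" where
  "word_weight x w = prod_list (map (\<lambda>l. x ((l + 1) div 2)) w)"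

definition dsum :: "(nat \<Rightarrow> 'a::comm_ring_1) \<Rightarrow> nat \<Rightarrow> nat \<Rightarrow> nat set \<Rightarrow> 'a" where
  "dsum x m n D = (\<Sum>w\<in>dwords m n D. word_weight x w)"

section \<open>Products of ribbons and the generating function of one-row ribbons\<close>

lemma transp_row_le: "transp row_le"
  by (auto simp: transp_def row_le_def)

lemma finite_dwords: "finite (dwords m n D)"
  by (rule finite_subset[OF _ finite_lists_length_eq[of "{1..m}" n]]) (auto simp: dwords_def)

lemma dwords_empty:
  "dwords m n {} = {w. length w = n \<and> set w \<subseteq> {1..m} \<and> sorted_wrt row_le w}"
  by (auto simp: dwords_def sorted_wrt_iff_nth_Suc_transp[OF transp_row_le])

lemma dwords_empty_0: "dwords m 0 {} = {[]}"
  by (auto simp: dwords_def)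

text \<open>Concatenating a row of d boxes with a ribbon of n - d boxes leaves the relation across
  the joint free: if it is \<open>row_le\<close>, the row ends are D, otherwise d is a row end too.
  As d lies below D, the first d boxes form one row.\<close>

lemma dsum_split:
  assumes "0 < d" "d < n" "\<And>e. e \<in> D \<Longrightarrow> d < e"
  shows "dsum x m d {} * dsum x m (n - d) {e. 0 < e \<and> e + d \<in> D} =
    dsum x m n (insert d D) + dsum x m n D"
proof -
  let ?D = "{e. 0 < e \<and> e + d \<in> D}"
  have "d \<notin> D"
    using assms(3) by blast
  have mem: "u \<in> dwords m n (insert d D) \<union> dwords m n D"
    if "length u = n" "set u \<subseteq> {1..m}"
      and step: "\<And>i. Suc i < n \<Longrightarrow> Suc i \<noteq> d \<Longrightarrow> row_le (u ! i) (u ! Suc i) \<longleftrightarrow> Suc i \<notin> D" for u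
  proof -
    define E where "E = (if row_le (u ! (d - 1)) (u ! d) then D else insert d D)"
    have "row_le (u ! i) (u ! Suc i) \<longleftrightarrow> Suc i \<notin> E" if "Suc i < n" for i
      using step[OF that] \<open>d \<notin> D\<close> by (cases "Suc i = d") (auto simp: E_def)
    then have "u \<in> dwords m n E"
      using that by (simp add: dwords_def)
    then show ?thesis
      by (auto simp: E_def split: if_splits)
  qed
  have "(\<Sum>(v, w)\<in>dwords m d {} \<times> dwords m (n - d) ?D. word_weight x v * word_weight x w) =
    (\<Sum>u\<in>dwords m n (insert d D) \<union> dwords m n D. word_weight x u)"
  proof (rule sum.reindex_bij_witness[of _ "\<lambda>u. (take d u, drop d u)" "\<lambda>(v, w). v @ w"])
    fix p
    assume p: "p \<in> dwords m d {} \<times> dwords m (n - d) ?D"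
    obtain v w where vw: "p = (v, w)" "v \<in> dwords m d {}" "w \<in> dwords m (n - d) ?D"
      using p by auto
    then show "(take d (case p of (v, w) \<Rightarrow> v @ w), drop d (case p of (v, w) \<Rightarrow> v @ w)) = p"
      using vw by (simp add: dwords_def)
    have "row_le ((v @ w) ! i) ((v @ w) ! Suc i) \<longleftrightarrow> Suc i \<notin> D"
      if "Suc i < n" "Suc i \<noteq> d" for i
    proof (cases "Suc i < d")
      case True
      moreover have "Suc i \<notin> D"
        using True assms(3) by fastforce
      ultimately show ?thesis
        using vw by (auto simp: dwords_def nth_append)
    next
      case False
      then have "d \<le> i"
        using that by linarith
      then obtain j where j: "i = d + j"
        using le_Suc_ex by blast
      have "length v = d" "length w = n - d"
        using vw by (auto simp: dwords_def)
      then have "(v @ w) ! i = w ! j" "(v @ w) ! Suc i = w ! Suc j"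
        unfolding j nth_append by simp_all
      moreover have "row_le (w ! j) (w ! Suc j) \<longleftrightarrow> Suc j \<notin> ?D"
        using vw(3) that(1) j by (simp add: dwords_def)
      moreover have "Suc j \<in> ?D \<longleftrightarrow> Suc i \<in> D"
        unfolding j by (simp add: add.commute)
      ultimately show ?thesis
        by simp
    qed
    moreover have "length (v @ w) = n" "set (v @ w) \<subseteq> {1..m}"
      using vw assms by (auto simp: dwords_def)
    ultimately have "v @ w \<in> dwords m n (insert d D) \<union> dwords m n D"
      by (rule mem[rotated 2])
    then show "(case p of (v, w) \<Rightarrow> v @ w) \<in> dwords m n (insert d D) \<union> dwords m n D"
      using vw by simp
    show "word_weight x (case p of (v, w) \<Rightarrow> v @ w) =
        (case p of (v, w) \<Rightarrow> word_weight x v * word_weight x w)"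
      using vw by (simp add: word_weight_def)
  next
    fix u
    assume u: "u \<in> dwords m n (insert d D) \<union> dwords m n D"
    then show "(case (take d u, drop d u) of (v, w) \<Rightarrow> v @ w) = u"
      by simp
    have len: "length u = n" and set: "set u \<subseteq> {1..m}"
      using u by (auto simp: dwords_def)
    have step: "row_le (u ! i) (u ! Suc i) \<longleftrightarrow> Suc i \<notin> D" if "Suc i < n" "Suc i \<noteq> d" for i
      using u that by (auto simp: dwords_def)
    have "take d u \<in> dwords m d {}"
      using len set assms step set_take_subset[of d u] by (fastforce simp: dwords_def)
    moreover have "drop d u \<in> dwords m (n - d) ?D"
      using len set assms step set_drop_subset[of d u]
      by (auto simp: dwords_def add.commute)
    ultimately show "(take d u, drop d u) \<in> dwords m d {} \<times> dwords m (n - d) ?D"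
      by simp
  qed
  also have "\<dots> = dsum x m n (insert d D) + dsum x m n D"
    unfolding dsum_def
  proof (rule sum.union_disjoint)
    have "Suc (d - 1) < n" "Suc (d - 1) = d"
      using assms by auto
    then show "dwords m n (insert d D) \<inter> dwords m n D = {}"
      using \<open>d \<notin> D\<close> unfolding dwords_def by (auto dest!: spec[of _ "d - 1"])
  qed (auto simp: finite_dwords)
  finally show ?thesis
    by (simp add: dsum_def sum_product sum.cartesian_product)
qed

text \<open>Splitting off a trailing largest letter: an unmarked (even) letter may repeat in a
  row, a marked (odd) one may not.\<close>

lemma dsum_empty_Suc:
  "dsum x (Suc m) (Suc n) {} =
    dsum x m (Suc n) {} + x ((m + 2) div 2) * dsum x (if odd m then Suc m else m) n {}"
proof -
  let ?k = "if odd m then Suc m else m"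
  have eq: "dwords (Suc m) (Suc n) {} = dwords m (Suc n) {} \<union> (\<lambda>w. w @ [Suc m]) ` dwords ?k n {}"
  proof (intro set_eqI iffI)
    fix w
    assume w: "w \<in> dwords (Suc m) (Suc n) {}"
    then obtain v l where vl: "w = v @ [l]"
      by (cases w rule: rev_cases) (auto simp: dwords_empty)
    show "w \<in> dwords m (Suc n) {} \<union> (\<lambda>w. w @ [Suc m]) ` dwords ?k n {}"
    proof (cases "l = Suc m")
      case True
      have "y \<noteq> Suc m" if "y \<in> set v" "even m" for y
        using w vl that True by (auto simp: dwords_empty sorted_wrt_append row_le_def)
      moreover have "y \<le> Suc m" "1 \<le> y" if "y \<in> set v" for y
        using w vl that by (auto simp: dwords_empty)
      ultimately have "v \<in> dwords ?k n {}"
        using w vl by (fastforce simp: dwords_empty sorted_wrt_append le_Suc_eq)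
      then show ?thesis
        using True vl by auto
    next
      case False
      have l: "l \<le> m" "1 \<le> l"
        using w vl False by (auto simp: dwords_empty)
      moreover have "y \<le> m" "1 \<le> y" if "y \<in> set v" for y
        using w vl l that by (auto simp: dwords_empty sorted_wrt_append row_le_def)
      ultimately show ?thesis
        using w vl by (auto simp: dwords_empty)
    qed
  next
    fix w
    assume "w \<in> dwords m (Suc n) {} \<union> (\<lambda>w. w @ [Suc m]) ` dwords ?k n {}"
    then show "w \<in> dwords (Suc m) (Suc n) {}"
      by (fastforce simp: dwords_empty sorted_wrt_append row_le_def le_Suc_eq split: if_splits)
  qed
  have disj: "dwords m (Suc n) {} \<inter> (\<lambda>w. w @ [Suc m]) ` dwords ?k n {} = {}"
    by (auto simp: dwords_empty)
  have "dsum x (Suc m) (Suc n) {} = dsum x m (Suc n) {} +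
      (\<Sum>w\<in>(\<lambda>w. w @ [Suc m]) ` dwords ?k n {}. word_weight x w)"
    unfolding dsum_def eq by (rule sum.union_disjoint) (use disj in \<open>auto simp: finite_dwords\<close>)
  also have "(\<Sum>w\<in>(\<lambda>w. w @ [Suc m]) ` dwords ?k n {}. word_weight x w) =
      x ((m + 2) div 2) * dsum x ?k n {}"
    by (subst sum.reindex) (auto simp: inj_on_def word_weight_def dsum_def sum_distrib_left mult.commute)
  finally show ?thesis .
qed

lemma dsum_empty_0: "dsum x m 0 {} = 1"
  by (simp add: dsum_def dwords_empty_0 word_weight_def)

text \<open>The marked letter of the new variable x occurs at most once in a row and contributes 1 +
  x X; the unmarked one occurs any number of times and contributes 1 / (1 - x X).\<close>

lemma dsum_fps_step:
  fixes x :: "nat \<Rightarrow> 'a::comm_ring_1"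
  defines "Q \<equiv> \<lambda>m. Abs_fps (\<lambda>n. dsum x m n {})"
  shows "Q (2 * Suc N) * (1 - fps_const (x (Suc N)) * fps_X) =
    Q (2 * N) * (1 + fps_const (x (Suc N)) * fps_X)"
proof -
  let ?X = "fps_const (x (Suc N)) * fps_X"
  have "Q (Suc (2 * N)) = Q (2 * N) + ?X * Q (2 * N)"
  proof (rule fps_ext)
    show "Q (Suc (2 * N)) $ n = (Q (2 * N) + ?X * Q (2 * N)) $ n" for n
      by (cases n) (simp_all add: Q_def dsum_empty_0 dsum_empty_Suc mult.assoc)
  qed
  moreover have "Q (Suc (Suc (2 * N))) = Q (Suc (2 * N)) + ?X * Q (Suc (Suc (2 * N)))"
  proof (rule fps_ext)
    show "Q (Suc (Suc (2 * N))) $ n = (Q (Suc (2 * N)) + ?X * Q (Suc (Suc (2 * N)))) $ n" for n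
      by (cases n) (simp_all add: Q_def dsum_empty_0 dsum_empty_Suc mult.assoc del: mult_Suc_right)
  qed
  ultimately show ?thesis
    by (simp add: algebra_simps)
qed

text \<open>With denominators cleared, the generating function of Schur's symmetric functions q_n in
  x_1, ..., x_N.\<close>

lemma dsum_fps:
  "Abs_fps (\<lambda>n. dsum x (2 * N) n {}) * (\<Prod>j=1..N. 1 - fps_const (x j) * fps_X) =
    (\<Prod>j=1..N. 1 + fps_const (x j) * fps_X)"
proof (induction N)
  case 0
  have "dwords 0 (Suc n) {} = {}" for n
    by (auto simp: dwords_def)
  then have "dsum x 0 n {} = (if n = 0 then 1 else 0)" for n
    by (cases n) (simp add: dsum_empty_0, simp add: dsum_def)
  then show ?case
    by (auto intro: fps_ext)
next
  case (Suc N)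
  let ?Q = "\<lambda>m. Abs_fps (\<lambda>n. dsum x m n {})"
  have "?Q (2 * Suc N) * (\<Prod>j=1..Suc N. 1 - fps_const (x j) * fps_X) =
      (?Q (2 * Suc N) * (1 - fps_const (x (Suc N)) * fps_X)) * (\<Prod>j=1..N. 1 - fps_const (x j) * fps_X)"
    by (simp add: mult_ac)
  also have "\<dots> = (?Q (2 * N) * (\<Prod>j=1..N. 1 - fps_const (x j) * fps_X)) * (1 + fps_const (x (Suc N)) * fps_X)"
    unfolding dsum_fps_step by (simp only: mult_ac)
  finally show ?case
    unfolding Suc.IH by (simp add: mult_ac)
qed

lemma prod_unity_roots_fps:
  fixes e :: complex
  assumes "n > 0"
  shows "(\<Prod>z\<in>{z. z ^ n = 1}. 1 - fps_const (e * z) * fps_X) = 1 - fps_const (e ^ n) * fps_X ^ n"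
proof -
  have "(\<Prod>z\<in>{z. z ^ n = 1}. [:1, - (e * z):]) = 1 - monom (e ^ n) n"
  proof (rule poly_ext)
    fix t
    show "poly (\<Prod>z\<in>{z. z ^ n = 1}. [:1, - (e * z):]) t = poly (1 - monom (e ^ n) n) t"
      using prod_unity_roots[OF assms, of "e * t"]
      by (simp add: poly_prod poly_monom power_mult_distrib mult_ac)
  qed
  then have "fps_of_poly (\<Prod>z\<in>{z. z ^ n = 1}. [:1, - (e * z):]) = fps_of_poly (1 - monom (e ^ n) n)"
    by (rule arg_cong)
  moreover have "fps_of_poly [:1, - (e * z):] = 1 - fps_const (e * z) * fps_X" for z
    by (simp add: fps_of_poly_pCons flip: fps_const_neg)
  ultimately show ?thesis
    by (simp only: fps_of_poly_prod) (simp add: fps_of_poly_diff fps_of_poly_monom)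
qed

lemma dsum_alphabet3:
  assumes "odd a" "odd b" "odd c"
  shows "dsum (alphabet3 a b c e1 e2 e3) (2 * (a + b + c)) n {} =
    qcoef3 a b c (e1 ^ a) (e2 ^ b) (e3 ^ c) n"
proof -
  let ?x = "alphabet3 a b c e1 e2 e3"
  have pos: "a > 0" "b > 0" "c > 0"
    using assms by (auto intro: Nat.gr0I)
  \<comment> \<open>Oddness of the orders enters here: replacing e by -e turns e^k into its
    negative.\<close>
  have plus: "(\<Prod>z\<in>{z. z ^ k = 1}. 1 + fps_const (e * z) * fps_X) = 1 + fps_const (e ^ k) * fps_X ^ k"
    if "odd k" for e :: complex and k
    using prod_unity_roots_fps[of k "- e"] that
    by (simp add: odd_pos flip: fps_const_neg)
  let ?A = "1 - fps_const (e1 ^ a) * fps_X ^ a" and ?B = "1 - fps_const (e2 ^ b) * fps_X ^ b"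
    and ?C = "1 - fps_const (e3 ^ c) * fps_X ^ c"
  let ?q = "Abs_fps (qcoef1 a (e1 ^ a)) * Abs_fps (qcoef1 b (e2 ^ b)) * Abs_fps (qcoef1 c (e3 ^ c))"
  have "Abs_fps (\<lambda>n. dsum ?x (2 * (a + b + c)) n {}) * (?A * ?B * ?C) =
    (1 + fps_const (e1 ^ a) * fps_X ^ a) * (1 + fps_const (e2 ^ b) * fps_X ^ b) *
    (1 + fps_const (e3 ^ c) * fps_X ^ c)"
    using dsum_fps[of ?x "a + b + c"]
    unfolding prod_alphabet3[OF pos, of "\<lambda>z. 1 - fps_const z * fps_X"]
      prod_alphabet3[OF pos, of "\<lambda>z. 1 + fps_const z * fps_X"]
      plus[OF assms(1)] plus[OF assms(2)] plus[OF assms(3)]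
      prod_unity_roots_fps[OF pos(1)] prod_unity_roots_fps[OF pos(2)] prod_unity_roots_fps[OF pos(3)] .
  also have "\<dots> = ?q * (?A * ?B * ?C)"
    unfolding qcoef1_fps[OF pos(1), symmetric] qcoef1_fps[OF pos(2), symmetric]
      qcoef1_fps[OF pos(3), symmetric] by (simp only: mult_ac)
  finally have "Abs_fps (\<lambda>n. dsum ?x (2 * (a + b + c)) n {}) * (?A * ?B * ?C) = ?q * (?A * ?B * ?C)" .
  \<comment> \<open>A constant term 1 makes each denominator nonzero, so they cancel in the domain
    of power series.\<close>
  moreover have "1 - fps_const u * fps_X ^ k \<noteq> 0" if "k > 0" for u :: complex and k
  proof
    assume "1 - fps_const u * fps_X ^ k = 0"
    moreover have "(1 - fps_const u * fps_X ^ k) $ 0 = 1"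
      using that by simp
    ultimately show False
      by (metis fps_zero_nth zero_neq_one)
  qed
  then have "?A * ?B * ?C \<noteq> 0"
    using pos by (simp only: mult_eq_0_iff) blast
  ultimately have "Abs_fps (\<lambda>n. dsum ?x (2 * (a + b + c)) n {}) = ?q"
    using mult_right_cancel by blast
  then show ?thesis
    unfolding qcoef3_def by (metis fps_nth_Abs_fps)
qed

section \<open>The coefficient of u v w\<close>

text \<open>Signed counts of the ordered set partitions of the parts whose partial sums lie in D, with a
  factor 2 for each part.\<close>

definition chi1 :: "nat \<Rightarrow> nat set \<Rightarrow> nat \<Rightarrow> 'a::comm_ring_1" where
  "chi1 n D x = (-1) ^ card D * 2 * of_bool (n = x)"

definition chi2 :: "nat \<Rightarrow> nat set \<Rightarrow> nat \<Rightarrow> nat \<Rightarrow> 'a::comm_ring_1" where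
  "chi2 n D x y = (-1) ^ card D * 4 * of_bool (n = x + y) * (1 - of_bool (x \<in> D) - of_bool (y \<in> D))"

definition chi3 :: "nat \<Rightarrow> nat set \<Rightarrow> nat \<Rightarrow> nat \<Rightarrow> nat \<Rightarrow> 'a::comm_ring_1" where
  "chi3 n D x y z = (-1) ^ card D * 8 * of_bool (n = x + y + z) *
     ((1 - of_bool (x \<in> D) - of_bool (y \<in> D) - of_bool (z \<in> D)) *
      (1 - of_bool (x + y \<in> D) - of_bool (x + z \<in> D) - of_bool (y + z \<in> D))
      - of_bool (x \<in> D \<and> y + z \<in> D) - of_bool (y \<in> D \<and> x + z \<in> D)
      - of_bool (z \<in> D \<and> x + y \<in> D))"

section \<open>The recursion of the signed counts when the least row end d is split off\<close>

context
  fixes d n :: nat and D :: "nat set" and D2 :: "nat set"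
  assumes d: "0 < d" "d < n" and above: "\<forall>e\<in>D. d < e" and fin: "finite D"
  defines "D2 \<equiv> {e. 0 < e \<and> e + d \<in> D}"
begin

text \<open>\<open>D2\<close> consists of the row ends above d, renumbered for the ribbon left when
  the first d boxes are removed.\<close>

lemma card_shift: "card D2 = card D"
proof (rule bij_betw_same_card[of "\<lambda>e. e + d"])
  show "bij_betw (\<lambda>e. e + d) D2 D"
    by (rule bij_betw_byWitness[of _ "\<lambda>e. e - d"]) (use above in \<open>auto simp: D2_def less_imp_le\<close>)
qed

lemma card_insert_d: "card (insert d D) = Suc (card D)"
  using fin above by (subst card_insert_disjoint) auto

lemma chi1_insert: "chi1 n (insert d D) x = - chi1 n D x"
  unfolding chi1_def card_insert_d by simp

text \<open>An ordered set partition that uses d has it as first partial sum: its first block is x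
  or y, and the rest is counted on the shifted ends. For the others only the sign changes, because
  the set has one more element.\<close>

lemma chi2_insert:
  assumes "x > 0" "y > 0"
  shows "chi2 n (insert d D) x y =
    2 * of_bool (d = x) * chi1 (n - d) D2 y + 2 * of_bool (d = y) * chi1 (n - d) D2 x
    - (chi2 n D x y :: 'a::comm_ring_1)"
proof (cases "n = x + y")
  case True
  have s: "of_bool (v \<in> insert d D) = of_bool (d = v) + (of_bool (v \<in> D) :: 'a)" for v
    using above by auto
  have "d = x \<Longrightarrow> n - d = y" "d = y \<Longrightarrow> n - d = x"
    using True by auto
  then have *: "of_bool (d = x) * of_bool (n - d = y) = (of_bool (d = x) :: 'a)"
    "of_bool (d = y) * of_bool (n - d = x) = (of_bool (d = y) :: 'a)"
    by auto
  have "2 * of_bool (d = x) * chi1 (n - d) D2 y = ((-1) ^ card D * 4) * (of_bool (d = x) * of_bool (n - d = y) :: 'a)"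
    "2 * of_bool (d = y) * chi1 (n - d) D2 x = ((-1) ^ card D * 4) * (of_bool (d = y) * of_bool (n - d = x) :: 'a)"
    by (simp_all add: chi1_def card_shift)
  then show ?thesis
    unfolding * chi2_def card_insert_d s using True by (simp add: algebra_simps)
next
  case False
  then have "d = x \<Longrightarrow> n - d \<noteq> y" "d = y \<Longrightarrow> n - d \<noteq> x"
    using d(2) by auto
  then show ?thesis
    using False by (auto simp: chi2_def chi1_def)
qed

text \<open>As for \<open>chi2_insert\<close>, with a first block of one part followed by
  \<open>chi2\<close>, or of two parts followed by \<open>chi1\<close>. The factors 2 and 4 are
  coefficients of the one-row function of size d.\<close>

lemma chi3_insert:
  assumes "x > 0" "y > 0" "z > 0"
  shows "chi3 n (insert d D) x y z =
    2 * of_bool (d = x) * chi2 (n - d) D2 y z + 2 * of_bool (d = y) * chi2 (n - d) D2 x z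
    + 2 * of_bool (d = z) * chi2 (n - d) D2 x y + 4 * of_bool (d = x + y) * chi1 (n - d) D2 z
    + 4 * of_bool (d = x + z) * chi1 (n - d) D2 y + 4 * of_bool (d = y + z) * chi1 (n - d) D2 x
    - (chi3 n D x y z :: 'a::comm_ring_1)"
proof (cases "n = x + y + z")
  case True
  let ?\<sigma> = "(-1) ^ card D :: 'a"
  let ?t = "\<lambda>v. of_bool (v \<in> D) :: 'a" and ?\<delta> = "\<lambda>v. of_bool (d = v) :: 'a"
    and ?u = "\<lambda>v. of_bool (v \<in> D2) :: 'a" and ?s = "\<lambda>v. of_bool (v \<in> insert d D) :: 'a"
  have s: "?s v = ?\<delta> v + ?t v" for v
    using above by auto
  \<comment> \<open>A chain v < v + w of partial sums can use d only as its smaller member, because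
    d lies below D and w > 0.\<close>
  have prod: "?s v * ?s (v + w) = ?\<delta> v * ?u w + ?t v * ?t (v + w)" if "w > 0" for v w
    using above that by (fastforce simp: D2_def add.commute)
  \<comment> \<open>Expanding the product in \<open>chi3\<close> gives nine products of a single
    part with a pair. The three complementary ones, such as x with y + z, cancel, and the six chains
    of three-block partitions remain.\<close>
  have X: "chi3 n E x y z = (-1) ^ card E * 8 *
     (1 - S x - S y - S z - S (x + y) - S (x + z) - S (y + z) +
      (S x * S (x + y) + S x * S (x + z) + S y * S (y + x) + S y * S (y + z) + S z * S (z + x) + S z * S (z + y)))"
    if "S = (\<lambda>v. of_bool (v \<in> E))" for E and S :: "nat \<Rightarrow> 'a"
    unfolding chi3_def that using True by (simp add: of_bool_conj algebra_simps)
  have chi2: "2 * ?\<delta> u * chi2 (n - d) D2 v w = ?\<sigma> * 8 * (?\<delta> u - ?\<delta> u * ?u v - ?\<delta> u * ?u w)"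
    if "n = u + v + w" for u v w
    by (cases "d = u") (use that in \<open>auto simp: chi2_def card_shift algebra_simps\<close>)
  have chi1: "4 * ?\<delta> u * chi1 (n - d) D2 v = ?\<sigma> * 8 * ?\<delta> u" if "n = u + v" for u v
    by (cases "d = u") (use that in \<open>auto simp: chi1_def card_shift algebra_simps\<close>)
  have c: "2 * ?\<delta> x * chi2 (n - d) D2 y z = ?\<sigma> * 8 * (?\<delta> x - ?\<delta> x * ?u y - ?\<delta> x * ?u z)"
    "2 * ?\<delta> y * chi2 (n - d) D2 x z = ?\<sigma> * 8 * (?\<delta> y - ?\<delta> y * ?u x - ?\<delta> y * ?u z)"
    "2 * ?\<delta> z * chi2 (n - d) D2 x y = ?\<sigma> * 8 * (?\<delta> z - ?\<delta> z * ?u x - ?\<delta> z * ?u y)"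
    "4 * ?\<delta> (x + y) * chi1 (n - d) D2 z = ?\<sigma> * 8 * ?\<delta> (x + y)"
    "4 * ?\<delta> (x + z) * chi1 (n - d) D2 y = ?\<sigma> * 8 * ?\<delta> (x + z)"
    "4 * ?\<delta> (y + z) * chi1 (n - d) D2 x = ?\<sigma> * 8 * ?\<delta> (y + z)"
    using True by - (rule chi2 chi1; simp)+
  show ?thesis
    unfolding c X[OF refl] card_insert_d prod[OF assms(1)] prod[OF assms(2)] prod[OF assms(3)]
    unfolding s by (simp add: algebra_simps)
next
  case False
  then have "d = x \<Longrightarrow> n - d \<noteq> y + z" "d = y \<Longrightarrow> n - d \<noteq> x + z" "d = z \<Longrightarrow> n - d \<noteq> x + y"
    "d = x + y \<Longrightarrow> n - d \<noteq> z" "d = x + z \<Longrightarrow> n - d \<noteq> y" "d = y + z \<Longrightarrow> n - d \<noteq> x"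
    using d(2) by auto
  then have "2 * of_bool (d = x) * chi2 (n - d) D2 y z = (0 :: 'a)"
    "2 * of_bool (d = y) * chi2 (n - d) D2 x z = (0 :: 'a)"
    "2 * of_bool (d = z) * chi2 (n - d) D2 x y = (0 :: 'a)"
    "4 * of_bool (d = x + y) * chi1 (n - d) D2 z = (0 :: 'a)"
    "4 * of_bool (d = x + z) * chi1 (n - d) D2 y = (0 :: 'a)"
    "4 * of_bool (d = y + z) * chi1 (n - d) D2 x = (0 :: 'a)"
    unfolding chi1_def chi2_def by simp_all
  then show ?thesis
    using False by (simp add: chi3_def)
qed

end

text \<open>Induction on the number of row ends: \<open>dsum_split\<close> at the least end d yields
  q_d P2 - P1, where P2 belongs to the ribbon without its first d boxes and P1 to the ribbon with
  the two rows at d merged. Eight coefficients are carried along because that of u v w in a product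
  depends on the lower ones.\<close>

lemma dsum_poly_exists:
  assumes odd: "odd a" "odd b" "odd c"
  assumes "finite D" "D \<subseteq> {0<..<n}" "n > 0"
  shows "\<exists>P. (\<forall>e1 e2 e3. eval3 P (e1 ^ a) (e2 ^ b) (e3 ^ c) =
      dsum (alphabet3 a b c e1 e2 e3) (2 * (a + b + c)) n D) \<and>
    coeff3 P 0 0 0 = 0 \<and> coeff3 P 1 0 0 = chi1 n D a \<and> coeff3 P 0 1 0 = chi1 n D b \<and>
    coeff3 P 0 0 1 = chi1 n D c \<and> coeff3 P 1 1 0 = chi2 n D a b \<and> coeff3 P 1 0 1 = chi2 n D a c \<and>
    coeff3 P 0 1 1 = chi2 n D b c \<and> coeff3 P 1 1 1 = chi3 n D a b c"
    (is "\<exists>P. ?good n D P")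
  using assms(4-)
proof (induction "card D" arbitrary: n D rule: less_induct)
  case (less D)
  have pos: "a > 0" "b > 0" "c > 0"
    using odd by (auto intro: Nat.gr0I)
  show ?case
  proof (cases "D = {}")
    case True
    let ?P = "qpoly3 a b c n :: complex poly poly poly"
    have "?good n D ?P"
      unfolding True
      by (intro conjI allI; (simp only: dsum_alphabet3[OF odd] eval3_qcoef3 eval3_simps)?)
        (simp_all add: coeff3_qpoly3[OF pos] less.prems chi1_def chi2_def chi3_def)
    then show ?thesis
      by (rule exI)
  next
    case False
    define d where "d = Min D"
    define D1 where "D1 = D - {d}"
    define D2 where "D2 = {e. 0 < e \<and> e + d \<in> D1}"
    have "d \<in> D"
      using False less.prems by (simp add: d_def)
    have D: "D = insert d D1"
      using \<open>d \<in> D\<close> by (auto simp: D1_def)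
    have d: "0 < d" "d < n"
      using \<open>d \<in> D\<close> less.prems by auto
    have lt: "\<forall>e\<in>D1. d < e"
      using Min_le[OF less.prems(1)] by (auto simp: D1_def d_def order_less_le)
    have fin: "finite D1"
      using less.prems by (simp add: D1_def)
    have card: "card D1 < card D" "card D2 < card D"
      using card_insert_d[OF d lt fin] card_shift[OF d lt fin] by (simp_all add: D D2_def)
    have "finite D2"
      by (rule finite_subset[of _ "{..n}"]) (use less.prems in \<open>auto simp: D2_def D1_def\<close>)
    moreover have "D2 \<subseteq> {0<..<n - d}"
      using less.prems by (auto simp: D2_def D1_def)
    ultimately obtain P2 where P2: "?good (n - d) D2 P2"
      using less.hyps[OF card(2), of "n - d"] d by auto
    obtain P1 where P1: "?good n D1 P1"
      using less.hyps[OF card(1), of n] less.prems fin by (auto simp: D1_def)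
    let ?q = "qpoly3 a b c d :: complex poly poly poly"
    \<comment> \<open>The coefficient of u v w in \<open>?q\<close> is multiplied by the constant
      term 0 of \<open>P2\<close>, so the other seven determine the product.\<close>
    have q: "coeff3 ?q 0 0 0 = 0" "coeff3 ?q 1 0 0 = 2 * of_bool (d = a)"
      "coeff3 ?q 0 1 0 = 2 * of_bool (d = b)" "coeff3 ?q 0 0 1 = 2 * of_bool (d = c)"
      "coeff3 ?q 1 1 0 = 4 * of_bool (d = a + b)" "coeff3 ?q 1 0 1 = 4 * of_bool (d = a + c)"
      "coeff3 ?q 0 1 1 = 4 * of_bool (d = b + c)"
      using d by (simp_all add: coeff3_qpoly3[OF pos])
    have "eval3 (?q * P2 - P1) (e1 ^ a) (e2 ^ b) (e3 ^ c) =
        dsum (alphabet3 a b c e1 e2 e3) (2 * (a + b + c)) n D" for e1 e2 e3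
    proof -
      have "dsum x m d {} * dsum x m (n - d) D2 = dsum x m n D + dsum x m n D1" for m and x :: "nat \<Rightarrow> complex"
        unfolding D D2_def using lt d by (intro dsum_split) auto
      from this[of "alphabet3 a b c e1 e2 e3" "2 * (a + b + c)"] show ?thesis
        using P1 P2 unfolding dsum_alphabet3[OF odd] by (simp add: eval3_qcoef3)
    qed
    moreover note chi = chi1_insert[OF d lt fin, folded D] chi2_insert[OF d lt fin, folded D D2_def]
      chi3_insert[OF d lt fin, folded D D2_def]
    have "coeff3 (?q * P2 - P1) 0 0 0 = 0" "coeff3 (?q * P2 - P1) 1 0 0 = chi1 n D a"
      "coeff3 (?q * P2 - P1) 0 1 0 = chi1 n D b" "coeff3 (?q * P2 - P1) 0 0 1 = chi1 n D c"
      "coeff3 (?q * P2 - P1) 1 1 0 = chi2 n D a b" "coeff3 (?q * P2 - P1) 1 0 1 = chi2 n D a c"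
      "coeff3 (?q * P2 - P1) 0 1 1 = chi2 n D b c" "coeff3 (?q * P2 - P1) 1 1 1 = chi3 n D a b c"
      unfolding coeff3_diff coeff3_mult q chi(1) chi(2)[OF pos(1,2)] chi(2)[OF pos(1,3)]
        chi(2)[OF pos(2,3)] chi(3)[OF pos]
      using P1 P2 by simp_all
    ultimately have "?good n D (?q * P2 - P1)"
      by blast
    then show ?thesis
      by (rule exI)
  qed
qed

section \<open>Fillings as words\<close>

text \<open>Boxes are numbered along the ribbon from the bottom left end to the top right end:
  row r consists of the numbers from row_end r up to row_end (r - 1) - 1.\<close>

definition row_end :: "nat list \<Rightarrow> nat \<Rightarrow> nat" where
  "row_end \<alpha> r = sum_list (drop r \<alpha>)"

text \<open>The indices 0 and \<open>length \<alpha>\<close> would give the two ends of the ribbon;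
  those in between give the numbers at which a new row starts.\<close>

definition row_ends :: "nat list \<Rightarrow> nat set" where
  "row_ends \<alpha> = row_end \<alpha> ` {1..<length \<alpha>}"

text \<open>A step to the right or up raises the number by one: this is the diagonal c - r of the
  box, shifted to start at 0.\<close>

definition box_index :: "nat list \<Rightarrow> nat \<times> nat \<Rightarrow> nat" where
  "box_index \<alpha> b = snd b + (length \<alpha> - fst b)"

definition word_content :: "nat list \<Rightarrow> nat \<Rightarrow> nat" where
  "word_content w j = length (filter (\<lambda>l. (l + 1) div 2 = j) w)"

lemma transp_chain:
  fixes f :: "nat \<Rightarrow> 'a"
  assumes "transp R" "p < q" "\<And>i. p \<le> i \<Longrightarrow> i < q \<Longrightarrow> R (f i) (f (Suc i))"
  shows "R (f p) (f q)"
  using assms(2,3)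
proof (induction q)
  case (Suc q)
  show ?case
  proof (cases "p = q")
    case False
    then have "R (f p) (f q)" "R (f q) (f (Suc q))"
      using Suc by auto
    then show ?thesis
      using assms(1) by (blast dest: transpD)
  qed (use Suc.prems in auto)
qed simp

lemma transp_not_row_le: "transp (\<lambda>x y. \<not> row_le x y)"
  by (auto simp: transp_def row_le_def)

section \<open>Rows, columns and box numbers of a ribbon\<close>

context
  fixes \<alpha> :: "nat list"
  assumes ribbon: "is_ribbon \<alpha>"
begin

lemma row_end_0: "row_end \<alpha> 0 = sum_list \<alpha>"
  by (simp add: row_end_def)

lemma row_end_length: "row_end \<alpha> (length \<alpha>) = 0"
  by (simp add: row_end_def)

lemma row_end_step: "r < length \<alpha> \<Longrightarrow> row_end \<alpha> r = \<alpha> ! r + row_end \<alpha> (Suc r)"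
  by (simp add: row_end_def flip: Cons_nth_drop_Suc)

lemma row_pos: "r < length \<alpha> \<Longrightarrow> 0 < \<alpha> ! r"
  using ribbon by (simp add: is_ribbon_def)

lemma row_end_gap: "r \<le> r' \<Longrightarrow> r' \<le> length \<alpha> \<Longrightarrow> row_end \<alpha> r' + (r' - r) \<le> row_end \<alpha> r"
proof (induction r' rule: dec_induct)
  case (step m)
  then show ?case
    using row_end_step[of m] row_pos[of m] by simp
qed simp

lemma row_end_mono: "r \<le> r' \<Longrightarrow> r' \<le> length \<alpha> \<Longrightarrow> row_end \<alpha> r' \<le> row_end \<alpha> r"
  using row_end_gap[of r r'] by simp

lemma row_end_less: "r < r' \<Longrightarrow> r' \<le> length \<alpha> \<Longrightarrow> row_end \<alpha> r' < row_end \<alpha> r"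
  using row_end_gap[of r r'] by simp

text \<open>Consecutive rows share one column, so each of the \<open>length \<alpha> - r\<close>
  rows below row r accounts for one column fewer than it has boxes.\<close>

lemma row_start_eq: "r \<le> length \<alpha> \<Longrightarrow> row_start \<alpha> r + (length \<alpha> - r) = row_end \<alpha> r"
proof -
  have "sum_list (map (\<lambda>x. x - 1) xs) + length xs = sum_list xs" if "\<forall>x\<in>set xs. 0 < x"
    for xs :: "nat list"
    using that by (induction xs) auto
  from this[of "drop r \<alpha>"] show "row_start \<alpha> r + (length \<alpha> - r) = row_end \<alpha> r"
    using ribbon by (auto simp: row_start_def row_end_def is_ribbon_def dest: in_set_dropD)
qed

lemma mem_ribbon_boxes:
  "(r, c) \<in> ribbon_boxes \<alpha> \<longleftrightarrow> 1 \<le> r \<and> r \<le> length \<alpha> \<and>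
    row_end \<alpha> r \<le> box_index \<alpha> (r, c) \<and> box_index \<alpha> (r, c) < row_end \<alpha> (r - 1)"
proof (cases "1 \<le> r \<and> r \<le> length \<alpha>")
  case True
  then show ?thesis
    using row_start_eq[of r] row_end_step[of "r - 1"]
    by (auto simp: ribbon_boxes_def box_index_def)
qed (auto simp: ribbon_boxes_def)

lemma row_unique:
  assumes "row_end \<alpha> r \<le> i" "i < row_end \<alpha> (r - 1)" "row_end \<alpha> r' \<le> i" "i < row_end \<alpha> (r' - 1)"
    "1 \<le> r" "r \<le> length \<alpha>" "1 \<le> r'" "r' \<le> length \<alpha>"
  shows "r = r'"
proof (rule ccontr)
  assume "r \<noteq> r'"
  then consider "r \<le> r' - 1" | "r' \<le> r - 1"
    using assms by linarith
  moreover have "r - 1 \<le> length \<alpha>" "r' - 1 \<le> length \<alpha>"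
    using assms by auto
  ultimately show False
    using row_end_mono[of r "r' - 1"] row_end_mono[of r' "r - 1"] assms by cases linarith+
qed

lemma row_exists:
  assumes "i < sum_list \<alpha>"
  obtains r where "1 \<le> r" "r \<le> length \<alpha>" "row_end \<alpha> r \<le> i" "i < row_end \<alpha> (r - 1)"
proof -
  define r where "r = (LEAST r. row_end \<alpha> r \<le> i)"
  have *: "row_end \<alpha> (length \<alpha>) \<le> i"
    by (simp add: row_end_length)
  have r: "row_end \<alpha> r \<le> i" "r \<le> length \<alpha>"
    unfolding r_def by (rule LeastI[of _ "length \<alpha>"], rule *) (rule Least_le, rule *)
  have "r \<noteq> 0"
    using r assms row_end_0 by (intro notI) simp
  then have "\<not> row_end \<alpha> (r - 1) \<le> i"
    unfolding r_def by (intro not_less_Least) simp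
  then show ?thesis
    using r \<open>r \<noteq> 0\<close> by (intro that[of r]) auto
qed

lemma bij_box_index: "bij_betw (box_index \<alpha>) (ribbon_boxes \<alpha>) {..<sum_list \<alpha>}"
proof (rule bij_betwI')
  fix b b'
  assume b: "b \<in> ribbon_boxes \<alpha>" "b' \<in> ribbon_boxes \<alpha>"
  obtain r c r' c' where rc: "b = (r, c)" "b' = (r', c')"
    by fastforce
  have "r = r'" if "box_index \<alpha> b = box_index \<alpha> b'"
    using b that unfolding rc mem_ribbon_boxes
    by (intro row_unique[of r "box_index \<alpha> (r, c)" r']) auto
  then show "box_index \<alpha> b = box_index \<alpha> b' \<longleftrightarrow> b = b'"
    by (auto simp: rc box_index_def)
next
  fix b
  assume b: "b \<in> ribbon_boxes \<alpha>"
  obtain r c where rc: "b = (r, c)"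
    by fastforce
  show "box_index \<alpha> b \<in> {..<sum_list \<alpha>}"
    using b row_end_mono[of 0 "r - 1"] unfolding rc mem_ribbon_boxes row_end_0 lessThan_iff by linarith
next
  fix i
  assume "i \<in> {..<sum_list \<alpha>}"
  then obtain r where r: "1 \<le> r" "r \<le> length \<alpha>" "row_end \<alpha> r \<le> i" "i < row_end \<alpha> (r - 1)"
    using row_exists by blast
  then have "length \<alpha> - r \<le> i"
    using row_end_gap[of r "length \<alpha>"] by simp
  then have "box_index \<alpha> (r, i - (length \<alpha> - r)) = i"
    by (simp add: box_index_def)
  then show "\<exists>b\<in>ribbon_boxes \<alpha>. i = box_index \<alpha> b"
    using r by (intro bexI[of _ "(r, i - (length \<alpha> - r))"]) (auto simp: mem_ribbon_boxes)
qed

lemma not_row_end_in_row: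
  assumes "(r, c) \<in> ribbon_boxes \<alpha>" "(r, c') \<in> ribbon_boxes \<alpha>"
    "box_index \<alpha> (r, c) \<le> i" "i < box_index \<alpha> (r, c')"
  shows "Suc i \<notin> row_ends \<alpha>"
proof
  assume "Suc i \<in> row_ends \<alpha>"
  then obtain s where s: "1 \<le> s" "s < length \<alpha>" "row_end \<alpha> s = Suc i"
    by (auto simp: row_ends_def)
  have *: "row_end \<alpha> r < row_end \<alpha> s" "row_end \<alpha> s < row_end \<alpha> (r - 1)" "1 \<le> r" "r \<le> length \<alpha>"
    using assms s unfolding mem_ribbon_boxes by auto
  have "r \<le> s \<or> s \<le> r - 1"
    using s by linarith
  moreover have "r - 1 \<le> length \<alpha>"
    using * by simp
  ultimately show False
    using row_end_mono[of r s] row_end_mono[of s "r - 1"] * s by linarith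
qed

lemma row_end_in_column:
  assumes "(r, c) \<in> ribbon_boxes \<alpha>" "(r', c) \<in> ribbon_boxes \<alpha>"
    "box_index \<alpha> (r', c) \<le> i" "i < box_index \<alpha> (r, c)"
  shows "Suc i \<in> row_ends \<alpha>"
proof -
  have rr: "1 \<le> r" "r \<le> length \<alpha>" "1 \<le> r'" "r' \<le> length \<alpha>"
    and lo: "row_end \<alpha> r \<le> c + (length \<alpha> - r)" and hi: "c + (length \<alpha> - r') < row_end \<alpha> (r' - 1)"
    using assms(1,2) unfolding mem_ribbon_boxes by (auto simp: box_index_def)
  have i: "c + (length \<alpha> - r') \<le> i" "i < c + (length \<alpha> - r)"
    using assms(3,4) by (auto simp: box_index_def)
  \<comment> \<open>The box of column c in row s has number \<open>Suc i\<close>; the two gap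
    estimates below force it to be the first box of its row.\<close>
  define s where "s = c + length \<alpha> - Suc i"
  have s: "r \<le> s" "s \<le> r' - 1" "Suc i = c + (length \<alpha> - s)"
    using i rr by (auto simp: s_def)
  have "row_end \<alpha> s = Suc i"
    using row_end_gap[of r s] row_end_gap[of s "r' - 1"] lo hi s rr by linarith
  then show ?thesis
    using s rr by (auto simp: row_ends_def intro!: image_eqI[of _ _ s])
qed

text \<open>Adjacent boxes suffice because \<open>row_le\<close> and its negation are both
  transitive: the first governs rows read to the right, the second columns read upwards.\<close>

lemma valid_filling_iff:
  assumes T: "T \<in> ribbon_boxes \<alpha> \<rightarrow>\<^sub>E {1..}"
    and w: "\<And>b. b \<in> ribbon_boxes \<alpha> \<Longrightarrow> w (box_index \<alpha> b) = T b"
  shows "valid_filling \<alpha> T \<longleftrightarrow>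
    (\<forall>i. Suc i < sum_list \<alpha> \<longrightarrow> (row_le (w i) (w (Suc i)) \<longleftrightarrow> Suc i \<notin> row_ends \<alpha>))"
proof
  assume valid: "valid_filling \<alpha> T"
  show "\<forall>i. Suc i < sum_list \<alpha> \<longrightarrow> (row_le (w i) (w (Suc i)) \<longleftrightarrow> Suc i \<notin> row_ends \<alpha>)"
  proof (intro allI impI)
    fix i
    assume i: "Suc i < sum_list \<alpha>"
    obtain r where r: "1 \<le> r" "r \<le> length \<alpha>" "row_end \<alpha> r \<le> i" "i < row_end \<alpha> (r - 1)"
      using row_exists[of i] i by auto
    define c where "c = i - (length \<alpha> - r)"
    have c: "i = c + (length \<alpha> - r)"
      using row_end_gap[of r "length \<alpha>"] r by (simp add: c_def)
    have b: "(r, c) \<in> ribbon_boxes \<alpha>" "w i = T (r, c)"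
      using r w[of "(r, c)"] by (simp_all add: mem_ribbon_boxes box_index_def flip: c)
    show "row_le (w i) (w (Suc i)) \<longleftrightarrow> Suc i \<notin> row_ends \<alpha>"
    \<comment> \<open>The next box lies above the current one if the row is exhausted, and to its
      right otherwise.\<close>
    proof (cases "Suc i = row_end \<alpha> (r - 1)")
      case True
      then have r1: "r - 1 \<ge> 1"
        using i row_end_0 by (cases "r - 1") auto
      then have "Suc i \<in> row_ends \<alpha>"
        using r by (auto simp: row_ends_def True)
      moreover have b': "(r - 1, c) \<in> ribbon_boxes \<alpha>" "w (Suc i) = T (r - 1, c)"
        using r1 r c True w[of "(r - 1, c)"] row_end_less[of "r - 1 - 1" "r - 1"]
        by (simp_all add: mem_ribbon_boxes box_index_def Suc_diff_le)
      moreover have "T (r - 1, c) \<le> T (r, c)" "even (T (r - 1, c)) \<longrightarrow> T (r - 1, c) \<noteq> T (r, c)"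
        using valid b(1) b'(1) r(1) unfolding valid_filling_def by auto
      ultimately show ?thesis
        using b(2) by (auto simp: row_le_def)
    next
      case False
      then have "(r, Suc c) \<in> ribbon_boxes \<alpha>"
        using r c by (simp add: mem_ribbon_boxes box_index_def)
      moreover have "Suc i = box_index \<alpha> (r, Suc c)"
        using c by (simp add: box_index_def)
      ultimately have b': "(r, Suc c) \<in> ribbon_boxes \<alpha>" "w (Suc i) = T (r, Suc c)" "Suc i \<notin> row_ends \<alpha>"
        using w[of "(r, Suc c)"] b(1) not_row_end_in_row[of r c "Suc c" i] c
        by (auto simp: box_index_def)
      moreover have "T (r, c) \<le> T (r, Suc c)" "odd (T (r, c)) \<longrightarrow> T (r, c) \<noteq> T (r, Suc c)"
        using valid b(1) b'(1) unfolding valid_filling_def by auto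
      ultimately show ?thesis
        using b(2) by (auto simp: row_le_def)
    qed
  qed
next
  assume adj: "\<forall>i. Suc i < sum_list \<alpha> \<longrightarrow> (row_le (w i) (w (Suc i)) \<longleftrightarrow> Suc i \<notin> row_ends \<alpha>)"
  have bound: "box_index \<alpha> b < sum_list \<alpha>" if "b \<in> ribbon_boxes \<alpha>" for b
    using bij_betwE[OF bij_box_index] that by auto
  have row: "row_le (T (r, c)) (T (r, c'))"
    if b: "(r, c) \<in> ribbon_boxes \<alpha>" "(r, c') \<in> ribbon_boxes \<alpha>" "c < c'" for r c c'
  proof -
    have "row_le (w (box_index \<alpha> (r, c))) (w (box_index \<alpha> (r, c')))"
    proof (rule transp_chain[OF transp_row_le, where f = w])
      show "box_index \<alpha> (r, c) < box_index \<alpha> (r, c')"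
        using b by (simp add: box_index_def)
      show "row_le (w i) (w (Suc i))" if "box_index \<alpha> (r, c) \<le> i" "i < box_index \<alpha> (r, c')" for i
        using adj not_row_end_in_row[OF b(1,2) that] bound[OF b(2)] that by auto
    qed
    then show ?thesis
      using w b by simp
  qed
  have col: "\<not> row_le (T (r', c)) (T (r, c))"
    if b: "(r, c) \<in> ribbon_boxes \<alpha>" "(r', c) \<in> ribbon_boxes \<alpha>" "r < r'" for r r' c
  proof -
    have "\<not> row_le (w (box_index \<alpha> (r', c))) (w (box_index \<alpha> (r, c)))"
    proof (rule transp_chain[OF transp_not_row_le, where f = w])
      show "box_index \<alpha> (r', c) < box_index \<alpha> (r, c)"
        using b by (auto simp: box_index_def mem_ribbon_boxes)
      show "\<not> row_le (w i) (w (Suc i))" if "box_index \<alpha> (r', c) \<le> i" "i < box_index \<alpha> (r, c)" for i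
        using adj row_end_in_column[OF b(1,2) that] bound[OF b(1)] that by auto
    qed
    then show ?thesis
      using w b by simp
  qed
  show "valid_filling \<alpha> T"
    unfolding valid_filling_def
  proof (intro conjI T allI impI)
    fix r c r' c'
    assume b: "(r, c) \<in> ribbon_boxes \<alpha>" "(r', c') \<in> ribbon_boxes \<alpha>"
    show "T (r, c) \<le> T (r', c')" if "r = r' \<and> c \<le> c'"
      using row[of r c c'] b that by (cases "c = c'") (auto simp: row_le_def)
    show "T (r, c) \<le> T (r', c')" if "c = c' \<and> r \<le> r'"
      using col[of r c r'] b that by (cases "r = r'") (auto simp: row_le_def)
    show "T (r, c) \<noteq> T (r', c')" if "c = c' \<and> r \<noteq> r' \<and> even (T (r, c))"
    proof -
      \<comment> \<open>An even letter is \<open>row_le\<close> itself, so failure of the relation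
        in one direction excludes equality. Dually, an odd letter is not, which settles the next
        claim.\<close>
      have "\<not> row_le (T (r, c)) (T (r', c')) \<or> \<not> row_le (T (r', c')) (T (r, c))"
        using col[of r c r'] col[of r' c r] b that by (metis nat_neq_iff)
      then show ?thesis
        using that by (metis row_le_def)
    qed
    show "T (r, c) \<noteq> T (r', c')" if "r = r' \<and> c \<noteq> c' \<and> odd (T (r, c))"
    proof -
      have "row_le (T (r, c)) (T (r', c')) \<or> row_le (T (r', c')) (T (r, c))"
        using row[of r c c'] row[of r c' c] b that by (metis nat_neq_iff)
      then show ?thesis
        using that by (metis row_le_def less_irrefl)
    qed
  qed
qed

lemma ribbon_fn_eq_card_words:
  "ribbon_fn \<alpha> e = real (card {w. length w = sum_list \<alpha> \<and> set w \<subseteq> {1..} \<and>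
     (\<forall>i. Suc i < sum_list \<alpha> \<longrightarrow> (row_le (w ! i) (w ! Suc i) \<longleftrightarrow> Suc i \<notin> row_ends \<alpha>)) \<and>
     word_content w = e})" (is "_ = real (card ?W)")
proof -
  let ?B = "ribbon_boxes \<alpha>" and ?n = "sum_list \<alpha>"
  define box where "box = inv_into ?B (box_index \<alpha>)"
  have box: "box i \<in> ?B" "box_index \<alpha> (box i) = i" if "i < ?n" for i
    using that bij_box_index unfolding box_def bij_betw_def by (auto intro: inv_into_into f_inv_into_f)
  have box_inv: "box (box_index \<alpha> b) = b" "box_index \<alpha> b < ?n" if "b \<in> ?B" for b
    using that bij_box_index unfolding box_def bij_betw_def by (auto intro: inv_into_f_f)
  define to_word where "to_word T = map (\<lambda>i. T (box i)) [0..<?n]" for T :: "nat \<times> nat \<Rightarrow> nat"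
  define to_filling where "to_filling w = restrict (\<lambda>b. w ! box_index \<alpha> b) ?B" for w :: "nat list"
  have content_eq: "Defs.content \<alpha> T = word_content (to_word T)" for T
  proof
    fix j
    have "bij_betw (box_index \<alpha>) {b \<in> ?B. (T b + 1) div 2 = j}
        {i. i < ?n \<and> (T (box i) + 1) div 2 = j}"
      by (rule bij_betw_byWitness[of _ box]) (auto simp: box box_inv)
    moreover have "word_content (to_word T) j = card {i. i < ?n \<and> (T (box i) + 1) div 2 = j}"
      unfolding word_content_def length_filter_conv_card by (rule arg_cong[of _ _ card]) (auto simp: to_word_def)
    ultimately show "Defs.content \<alpha> T j = word_content (to_word T) j"
      unfolding Defs.content_def by (simp add: bij_betw_same_card)
  qed
  have "bij_betw to_word {T. valid_filling \<alpha> T \<and> (\<forall>i. Defs.content \<alpha> T i = e i)} ?W"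
  proof (rule bij_betw_byWitness[of _ to_filling])
    show "\<forall>T\<in>{T. valid_filling \<alpha> T \<and> (\<forall>i. Defs.content \<alpha> T i = e i)}. to_filling (to_word T) = T"
    proof (intro ballI)
      fix T
      assume "T \<in> {T. valid_filling \<alpha> T \<and> (\<forall>i. Defs.content \<alpha> T i = e i)}"
      then have T: "T \<in> ?B \<rightarrow>\<^sub>E {1..}"
        unfolding valid_filling_def by blast
      show "to_filling (to_word T) = T"
      proof
        fix b
        show "to_filling (to_word T) b = T b"
          using PiE_arb[OF T, of b] by (cases "b \<in> ?B") (simp_all add: to_filling_def to_word_def box_inv)
      qed
    qed
    have to_word_filling: "to_word (to_filling w) = w" if "length w = ?n" for w
      using that by (auto simp: to_word_def to_filling_def box intro: nth_equalityI)
    then show "\<forall>w\<in>?W. to_word (to_filling w) = w"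
      by simp
    show "to_word ` {T. valid_filling \<alpha> T \<and> (\<forall>i. Defs.content \<alpha> T i = e i)} \<subseteq> ?W"
    proof (rule image_subsetI)
      fix T
      assume "T \<in> {T. valid_filling \<alpha> T \<and> (\<forall>i. Defs.content \<alpha> T i = e i)}"
      then have valid: "valid_filling \<alpha> T" and e: "Defs.content \<alpha> T = e"
        by (simp_all add: fun_eq_iff)
      have T: "T \<in> ?B \<rightarrow>\<^sub>E {1..}"
        using valid unfolding valid_filling_def by blast
      have "T b \<in> {1..}" if "b \<in> ?B" for b
        using PiE_mem[OF T that] .
      then have "set (to_word T) \<subseteq> {1..}"
        using box(1) unfolding to_word_def set_map by (intro image_subsetI) simp
      then show "to_word T \<in> ?W"
        using valid e content_eq[of T] valid_filling_iff[OF T, of "\<lambda>i. to_word T ! i"]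
        by (simp add: to_word_def box_inv)
    qed
    show "to_filling ` ?W \<subseteq> {T. valid_filling \<alpha> T \<and> (\<forall>i. Defs.content \<alpha> T i = e i)}"
    proof (rule image_subsetI)
      fix w
      assume w: "w \<in> ?W"
      then have "set w \<subseteq> {1..}" "length w = ?n"
        by auto
      then have "w ! box_index \<alpha> b \<in> {1..}" if "b \<in> ?B" for b
        using box_inv(2)[OF that] by (metis nth_mem subsetD)
      then have "to_filling w \<in> ?B \<rightarrow>\<^sub>E {1..}"
        unfolding to_filling_def by (simp add: restrict_PiE_iff)
      from valid_filling_iff[OF this, of "\<lambda>i. w ! i"]
      have "valid_filling \<alpha> (to_filling w)"
        using w by (simp add: to_filling_def)
      then show "to_filling w \<in> {T. valid_filling \<alpha> T \<and> (\<forall>i. Defs.content \<alpha> T i = e i)}"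
        using w content_eq[of "to_filling w"] to_word_filling by simp
    qed
  qed
  then show ?thesis
    unfolding ribbon_fn_def by (simp add: bij_betw_same_card)
qed

end

section \<open>p-positivity as nonnegativity of character values\<close>

definition exponents :: "nat \<Rightarrow> nat \<Rightarrow> (nat \<Rightarrow> nat) set" where
  "exponents N n = {e. (\<forall>j. j \<notin> {1..N} \<longrightarrow> e j = 0) \<and> (\<Sum>j=1..N. e j) = n}"

text \<open>The degree n part of the series f at x_1, ..., x_N with all further variables set to 0,
  so that only finitely many terms occur.\<close>

definition evaluate :: "nat \<Rightarrow> nat \<Rightarrow> ((nat \<Rightarrow> nat) \<Rightarrow> real) \<Rightarrow> (nat \<Rightarrow> complex) \<Rightarrow> complex" where
  "evaluate N n f x = (\<Sum>e\<in>exponents N n. of_real (f e) * (\<Prod>j=1..N. x j ^ e j))"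

section \<open>Evaluating ribbon functions and power sums in finitely many variables\<close>

lemma finite_exponents: "finite (exponents N n)"
proof (rule finite_subset)
  show "exponents N n \<subseteq> {e. \<forall>j. (j \<in> {1..N} \<longrightarrow> e j \<in> {..n}) \<and> (j \<notin> {1..N} \<longrightarrow> e j = 0)}"
    by (auto simp: exponents_def intro!: member_le_sum)
  show "finite {e. \<forall>j. (j \<in> {1..N} \<longrightarrow> e j \<in> {..n}) \<and> (j \<notin> {1..N} \<longrightarrow> (e j :: nat) = 0)}"
    by (rule finite_set_of_finite_funs) auto
qed

text \<open>Coefficients of ribbon functions and of power sums both count objects with a given
  exponent vector; grouping the objects by this vector g turns the series into a sum over
  objects.\<close>

lemma sum_card_fibres:
  assumes "finite A" "g ` A \<subseteq> exponents N n"
  shows "(\<Sum>e\<in>exponents N n. of_nat (card {t\<in>A. g t = e}) * \<phi> e) = (\<Sum>t\<in>A. \<phi> (g t) :: complex)"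
proof -
  have "(\<Sum>e\<in>exponents N n. of_nat (card {t\<in>A. g t = e}) * \<phi> e) =
      (\<Sum>e\<in>exponents N n. \<Sum>t\<in>{t\<in>A. g t = e}. \<phi> (g t))"
    by (intro sum.cong) auto
  also have "\<dots> = (\<Sum>t\<in>A. \<phi> (g t))"
    by (rule sum.group) (use assms finite_exponents in auto)
  finally show ?thesis .
qed

lemma word_content_Nil: "word_content [] j = 0"
  and word_content_Cons: "word_content (l # w) j = of_bool ((l + 1) div 2 = j) + word_content w j"
  by (simp_all add: word_content_def)

lemma word_content_props:
  fixes x :: "nat \<Rightarrow> complex"
  assumes "set w \<subseteq> {1..2 * N}"
  shows "(\<Sum>j=1..N. word_content w j) = length w"
    and "j \<notin> {1..N} \<Longrightarrow> word_content w j = 0"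
    and "(\<Prod>j=1..N. x j ^ word_content w j) = word_weight x w"
proof -
  have val: "(l + 1) div 2 \<in> {1..N}" if "l \<in> set w" for l
    using that assms by force
  show "(\<Sum>j=1..N. word_content w j) = length w"
    using val
  proof (induction w)
    case (Cons l w)
    then have "(l + 1) div 2 \<in> {1..N}"
      by simp
    then have "(\<Sum>j=1..N. of_bool ((l + 1) div 2 = j)) = (1::nat)"
      by (simp add: of_bool_def)
    then show ?case
      using Cons by (simp only: word_content_Cons sum.distrib) simp
  qed (simp add: word_content_Nil)
  show "word_content w j = 0" if "j \<notin> {1..N}"
    using that val by (auto simp: word_content_def filter_empty_conv)
  show "(\<Prod>j=1..N. x j ^ word_content w j) = word_weight x w"
    using val
  proof (induction w)
    case (Cons l w)
    then have "(l + 1) div 2 \<in> {1..N}"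
      by simp
    moreover have "x j ^ of_bool ((l + 1) div 2 = j) = (if (l + 1) div 2 = j then x j else 1)" for j
      by simp
    ultimately have "(\<Prod>j=1..N. x j ^ of_bool ((l + 1) div 2 = j)) = x ((l + 1) div 2)"
      by (simp only: prod.delta finite_atLeastAtMost) simp
    then show ?case
      using Cons by (simp only: word_content_Cons power_add prod.distrib) (simp add: word_weight_def)
  qed (simp add: word_content_Nil word_weight_def)
qed

lemma evaluate_ribbon_fn:
  assumes "is_ribbon \<alpha>"
  shows "evaluate N (sum_list \<alpha>) (ribbon_fn \<alpha>) x = dsum x (2 * N) (sum_list \<alpha>) (row_ends \<alpha>)"
proof -
  let ?n = "sum_list \<alpha>"
  let ?W = "dwords (2 * N) ?n (row_ends \<alpha>)"
  have "ribbon_fn \<alpha> e = real (card {w\<in>?W. word_content w = e})" if e: "e \<in> exponents N ?n" for e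
  proof -
    \<comment> \<open>\<open>ribbon_fn\<close> allows all letters, but one beyond 2 N would give a
      variable beyond x_N a positive exponent.\<close>
    have "set w \<subseteq> {1..2 * N}" if "set w \<subseteq> {1..}" "word_content w = e" for w
    proof
      fix l
      assume l: "l \<in> set w"
      then have "word_content w ((l + 1) div 2) \<noteq> 0"
        by (auto simp: word_content_def filter_empty_conv)
      then have "(l + 1) div 2 \<in> {1..N}"
        using e that by (auto simp: exponents_def)
      then show "l \<in> {1..2 * N}"
        using l that(1) by auto
    qed
    then have "{w. length w = ?n \<and> set w \<subseteq> {1..} \<and>
        (\<forall>i. Suc i < ?n \<longrightarrow> (row_le (w ! i) (w ! Suc i) \<longleftrightarrow> Suc i \<notin> row_ends \<alpha>)) \<and> word_content w = e} =
        {w\<in>?W. word_content w = e}"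
      unfolding dwords_def by fastforce
    then show ?thesis
      using ribbon_fn_eq_card_words[OF assms, of e] by simp
  qed
  then have "evaluate N ?n (ribbon_fn \<alpha>) x =
      (\<Sum>e\<in>exponents N ?n. of_nat (card {w\<in>?W. word_content w = e}) * (\<Prod>j=1..N. x j ^ e j))"
    unfolding evaluate_def by (intro sum.cong) auto
  also have "\<dots> = (\<Sum>w\<in>?W. \<Prod>j=1..N. x j ^ word_content w j)"
  proof (rule sum_card_fibres[OF finite_dwords])
    show "word_content ` ?W \<subseteq> exponents N ?n"
      using word_content_props(1,2)[of _ N] by (auto simp: dwords_def exponents_def)
  qed
  also have "\<dots> = dsum x (2 * N) ?n (row_ends \<alpha>)"
    unfolding dsum_def by (intro sum.cong word_content_props(3)) (auto simp: dwords_def)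
  finally show ?thesis .
qed

lemma sum_lists_prod:
  fixes y :: "'b \<Rightarrow> 'c \<Rightarrow> 'a::comm_semiring_1"
  assumes "finite A"
  shows "(\<Sum>js | length js = length lam \<and> set js \<subseteq> A. \<Prod>i<length lam. y (js ! i) (lam ! i)) =
    prod_list (map (\<lambda>k. \<Sum>j\<in>A. y j k) lam)"
proof (induction lam)
  case Nil
  have "{js. length js = length [] \<and> set js \<subseteq> A} = {[]}"
    by auto
  then show ?case
    by simp
next
  case (Cons k lam)
  have "{js. length js = length (k # lam) \<and> set js \<subseteq> A} =
      (\<lambda>(j, js). j # js) ` (A \<times> {js. length js = length lam \<and> set js \<subseteq> A})"
    by (auto simp: length_Suc_conv)
  moreover have "inj_on (\<lambda>(j, js). j # js) (A \<times> {js. length js = length lam \<and> set js \<subseteq> A})"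
    by (auto simp: inj_on_def)
  ultimately have "(\<Sum>js | length js = length (k # lam) \<and> set js \<subseteq> A.
        \<Prod>i<length (k # lam). y (js ! i) ((k # lam) ! i)) =
      (\<Sum>(j, js)\<in>A \<times> {js. length js = length lam \<and> set js \<subseteq> A}.
        y j k * (\<Prod>i<length lam. y (js ! i) (lam ! i)))"
    by (simp add: sum.reindex case_prod_unfold prod.lessThan_Suc_shift del: prod.lessThan_Suc)
  also have "\<dots> = (\<Sum>j\<in>A. y j k) * prod_list (map (\<lambda>k. \<Sum>j\<in>A. y j k) lam)"
    by (simp add: Cons.IH flip: sum.cartesian_product sum_distrib_left sum_distrib_right)
  finally show ?case
    by simp
qed

lemma evaluate_psum:
  assumes lam: "lam \<in> partitions n"
  shows "(\<Sum>e\<in>exponents N n. of_nat (psum_coeff lam e) * (\<Prod>j=1..N. x j ^ e j)) =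
    prod_list (map (\<lambda>k. \<Sum>j=1..N. x j ^ k :: complex) lam)"
proof -
  define g where "g js = (\<lambda>j. \<Sum>i<length lam. if js ! i = j then lam ! i else 0)" for js :: "nat list"
  define A where "A = {js. length js = length lam \<and> set js \<subseteq> {1..N}}"
  have pos: "0 < lam ! i" if "i < length lam" for i
    using lam that by (simp add: partitions_def)
  have fin: "finite A"
    unfolding A_def using finite_lists_length_eq[of "{1..N}" "length lam"] by (simp add: conj_commute)
  have "psum_coeff lam e = card {js\<in>A. g js = e}" if e: "e \<in> exponents N n" for e
  proof -
    \<comment> \<open>Parts are positive, so every chosen index has a positive exponent and must be
      one of the N variables.\<close>
    have "j \<in> {1..N}" if js: "j \<in> set js" "length js = length lam" "g js = e" for j js
    proof (rule ccontr)
      assume "j \<notin> {1..N}"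
      then have "e j = 0"
        using e unfolding exponents_def by blast
      then have "g js j = 0"
        using js(3) by simp
      moreover obtain i where "i < length lam" "js ! i = j"
        using js(1,2) by (metis in_set_conv_nth)
      ultimately show False
        using pos[of i] by (auto simp: g_def dest: bspec[where x = i])
    qed
    moreover have e_eq: "(\<forall>j. e j = (\<Sum>i<length lam. if js ! i = j then lam ! i else 0)) \<longleftrightarrow> g js = e" for js
      unfolding g_def fun_eq_iff by metis
    ultimately have "{js. length js = length lam \<and> (\<forall>j\<in>set js. 1 \<le> j) \<and>
        (\<forall>j. e j = (\<Sum>i<length lam. if js ! i = j then lam ! i else 0))} = {js\<in>A. g js = e}"
      unfolding A_def e_eq by (intro Collect_cong iffI) (blast, auto)
    then show ?thesis
      by (simp add: psum_coeff_def)
  qed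
  then have "(\<Sum>e\<in>exponents N n. of_nat (psum_coeff lam e) * (\<Prod>j=1..N. x j ^ e j)) =
      (\<Sum>e\<in>exponents N n. of_nat (card {js\<in>A. g js = e}) * (\<Prod>j=1..N. x j ^ e j))"
    by (intro sum.cong) auto
  also have "\<dots> = (\<Sum>js\<in>A. \<Prod>j=1..N. x j ^ g js j)"
  proof (rule sum_card_fibres[OF fin], rule image_subsetI)
    fix js
    assume js: "js \<in> A"
    then have mem: "js ! i \<in> {1..N}" if "i < length lam" for i
      using that by (metis (mono_tags, lifting) A_def mem_Collect_eq nth_mem subsetD)
    have "(\<Sum>j=1..N. g js j) = (\<Sum>i<length lam. \<Sum>j=1..N. if js ! i = j then lam ! i else 0)"
      unfolding g_def by (rule sum.swap)
    also have "\<dots> = (\<Sum>i<length lam. lam ! i)"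
      using mem by (intro sum.cong) (auto simp: sum.delta)
    also have "\<dots> = n"
      using lam by (simp add: partitions_def sum_list_sum_nth atLeast0LessThan)
    finally show "g js \<in> exponents N n"
      using mem unfolding exponents_def g_def by (auto intro!: sum.neutral)
  qed
  also have "\<dots> = (\<Sum>js\<in>A. \<Prod>i<length lam. x (js ! i) ^ (lam ! i))"
  proof (rule sum.cong[OF refl])
    fix js
    assume js: "js \<in> A"
    then have mem: "js ! i \<in> {1..N}" if "i < length lam" for i
      using that by (metis (mono_tags, lifting) A_def mem_Collect_eq nth_mem subsetD)
    have "(\<Prod>j=1..N. x j ^ g js j) = (\<Prod>j=1..N. \<Prod>i<length lam. if js ! i = j then x j ^ (lam ! i) else 1)"
      unfolding g_def power_sum by (intro prod.cong) auto
    also have "\<dots> = (\<Prod>i<length lam. \<Prod>j=1..N. if js ! i = j then x j ^ (lam ! i) else 1)"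
      by (rule prod.swap)
    also have "\<dots> = (\<Prod>i<length lam. x (js ! i) ^ (lam ! i))"
      using mem by (intro prod.cong) (auto simp: prod.delta)
    finally show "(\<Prod>j=1..N. x j ^ g js j) = (\<Prod>i<length lam. x (js ! i) ^ (lam ! i))" .
  qed
  also have "\<dots> = prod_list (map (\<lambda>k. \<Sum>j=1..N. x j ^ k) lam)"
    unfolding A_def by (rule sum_lists_prod) simp
  finally show ?thesis .
qed

lemma evaluate_p_positive:
  assumes "p_positive f"
  obtains c where "\<And>lam. c lam \<ge> 0"
    "\<And>N n x. evaluate N n f x =
      (\<Sum>lam\<in>partitions n. of_real (c lam) * prod_list (map (\<lambda>k. \<Sum>j=1..N. x j ^ k) lam))"
proof -
  obtain c where c: "\<And>lam. c lam \<ge> 0" "\<And>a. finite {i. a i \<noteq> 0} \<Longrightarrow>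
      f a = (\<Sum>lam\<in>partitions (\<Sum>i\<in>{i. a i \<noteq> 0}. a i). c lam * real (psum_coeff lam a))"
    using assms unfolding p_positive_def by blast
  have f: "f e = (\<Sum>lam\<in>partitions n. c lam * real (psum_coeff lam e))" if "e \<in> exponents N n" for e N n
  proof -
    have sub: "{i. e i \<noteq> 0} \<subseteq> {1..N}"
      using that by (auto simp: exponents_def)
    have "(\<Sum>i\<in>{i. e i \<noteq> 0}. e i) = (\<Sum>i=1..N. e i)"
      by (rule sum.mono_neutral_left) (use sub in auto)
    also have "\<dots> = n"
      using that by (simp add: exponents_def)
    finally show ?thesis
      using c(2)[of e] finite_subset[OF sub] by simp
  qed
  have "evaluate N n f x =
      (\<Sum>lam\<in>partitions n. of_real (c lam) * prod_list (map (\<lambda>k. \<Sum>j=1..N. x j ^ k) lam))" for N n x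
  proof -
    have "evaluate N n f x = (\<Sum>e\<in>exponents N n. \<Sum>lam\<in>partitions n.
        of_real (c lam) * (of_nat (psum_coeff lam e) * (\<Prod>j=1..N. x j ^ e j)))"
      unfolding evaluate_def by (intro sum.cong) (auto simp: f sum_distrib_right mult.assoc)
    also have "\<dots> = (\<Sum>lam\<in>partitions n. \<Sum>e\<in>exponents N n.
        of_real (c lam) * (of_nat (psum_coeff lam e) * (\<Prod>j=1..N. x j ^ e j)))"
      by (rule sum.swap)
    also have "\<dots> = (\<Sum>lam\<in>partitions n. of_real (c lam) * prod_list (map (\<lambda>k. \<Sum>j=1..N. x j ^ k) lam))"
      by (intro sum.cong refl) (simp only: evaluate_psum flip: sum_distrib_left)
    finally show ?thesis .
  qed
  with c(1) show ?thesis
    by (rule that)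
qed

section \<open>Polynomials with nonnegative coefficients and the resulting positivity
  criterion\<close>

definition nonneg_coeffs :: "complex poly poly poly \<Rightarrow> bool" where
  "nonneg_coeffs P \<longleftrightarrow> (\<forall>i j k. coeff3 P i j k \<in> \<real>\<^sub>\<ge>\<^sub>0)"

lemma sum_nonneg_Reals: "(\<And>i. i \<in> A \<Longrightarrow> f i \<in> \<real>\<^sub>\<ge>\<^sub>0) \<Longrightarrow> sum f A \<in> (\<real>\<^sub>\<ge>\<^sub>0 :: complex set)"
  by (induction A rule: infinite_finite_induct) (auto intro: nonneg_Reals_add_I)

lemma nonneg_coeffs_mult: "nonneg_coeffs P \<Longrightarrow> nonneg_coeffs Q \<Longrightarrow> nonneg_coeffs (P * Q)"
  unfolding nonneg_coeffs_def coeff3_def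
  by (auto simp: coeff_mult coeff_sum intro!: sum_nonneg_Reals nonneg_Reals_mult_I)

lemma nonneg_coeffs_add: "nonneg_coeffs P \<Longrightarrow> nonneg_coeffs Q \<Longrightarrow> nonneg_coeffs (P + Q)"
  by (auto simp: nonneg_coeffs_def coeff3_def intro: nonneg_Reals_add_I)

lemma nonneg_coeffs_0: "nonneg_coeffs 0"
  by (simp add: nonneg_coeffs_def coeff3_def)

lemma nonneg_coeffs_1: "nonneg_coeffs 1"
  using coeff3_var_power(1)[of 0, where ?'a = complex] by (simp add: nonneg_coeffs_def)

lemma nonneg_coeffs_const: "r \<ge> 0 \<Longrightarrow> nonneg_coeffs [:[:[:of_real r:]:]:]"
  by (auto simp: nonneg_coeffs_def coeff3_def coeff_pCons split: nat.split)

lemma nonneg_coeffs_sum: "(\<And>i. i \<in> A \<Longrightarrow> nonneg_coeffs (F i)) \<Longrightarrow> nonneg_coeffs (sum F A)"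
  by (induction A rule: infinite_finite_induct) (auto intro: nonneg_coeffs_0 nonneg_coeffs_add)

lemma nonneg_coeffs_prod_list: "(\<And>P. P \<in> set Ps \<Longrightarrow> nonneg_coeffs P) \<Longrightarrow> nonneg_coeffs (prod_list Ps)"
  by (induction Ps) (auto intro: nonneg_coeffs_1 nonneg_coeffs_mult)

lemma nonneg_coeffs_psum_term:
  assumes "\<And>m. nonneg_coeffs (U ^ m)"
  shows "nonneg_coeffs (psum_term a U k)"
proof -
  have "nonneg_coeffs (of_nat m)" for m
    by (induction m) (auto intro: nonneg_coeffs_0 nonneg_coeffs_1 nonneg_coeffs_add)
  then show ?thesis
    using assms by (auto simp: psum_term_def intro: nonneg_coeffs_0 nonneg_coeffs_mult)
qed

lemma eval3_psum_term: "eval3 (psum_term a U k) u v w = psum_term a (eval3 U u v w) k"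
proof -
  have "eval3 (of_nat m) u v w = of_nat m" for m
    by (induction m) auto
  then show ?thesis
    by (simp add: psum_term_def)
qed

lemma row_ends_bounds:
  assumes "is_ribbon \<alpha>"
  shows "finite (row_ends \<alpha>)" "row_ends \<alpha> \<subseteq> {0<..<sum_list \<alpha>}" "card (row_ends \<alpha>) = length \<alpha> - 1"
proof -
  note less = row_end_less[OF assms]
  show "finite (row_ends \<alpha>)"
    by (simp add: row_ends_def)
  show "row_ends \<alpha> \<subseteq> {0<..<sum_list \<alpha>}"
    using less[of 0] less[of _ "length \<alpha>"]
    by (auto simp: row_ends_def row_end_0[OF assms] row_end_length[OF assms])
  have "inj_on (row_end \<alpha>) {1..<length \<alpha>}"
  proof (rule linorder_inj_onI')
    show "row_end \<alpha> i \<noteq> row_end \<alpha> j" if "i \<in> {1..<length \<alpha>}" "j \<in> {1..<length \<alpha>}" "i < j" for i j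
      using less[of i j] that by auto
  qed
  then show "card (row_ends \<alpha>) = length \<alpha> - 1"
    by (simp add: row_ends_def card_image)
qed

text \<open>On the alphabet, the ribbon function gives a polynomial P and its power sum expansion a
  polynomial Q in u, v, w. They agree on an infinite grid, so P = Q; the coefficients of Q are
  nonnegative, and that of u v w is known from P.\<close>

lemma p_positive_imp_chi3_nonneg:
  assumes ribbon: "is_ribbon \<alpha>" and p: "p_positive (ribbon_fn \<alpha>)"
    and odd: "odd a" "odd b" "odd c" and n: "n = sum_list \<alpha>"
  shows "0 \<le> (chi3 n (row_ends \<alpha>) a b c :: int)"
proof -
  have pos: "a > 0" "b > 0" "c > 0"
    using odd by (auto intro: Nat.gr0I)
  have "n > 0"
    using ribbon by (auto simp: n is_ribbon_def neq_Nil_conv)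
  let ?x = "alphabet3 a b c"
  obtain P where P: "\<And>e1 e2 e3. eval3 P (e1 ^ a) (e2 ^ b) (e3 ^ c) =
      dsum (?x e1 e2 e3) (2 * (a + b + c)) n (row_ends \<alpha>)"
    "coeff3 P 1 1 1 = chi3 n (row_ends \<alpha>) a b c"
    using dsum_poly_exists[OF odd row_ends_bounds(1,2)[OF ribbon], folded n] \<open>n > 0\<close> by blast
  obtain h where h: "\<And>lam. h lam \<ge> 0" "\<And>N n x. evaluate N n (ribbon_fn \<alpha>) x =
      (\<Sum>lam\<in>partitions n. of_real (h lam) * prod_list (map (\<lambda>k. \<Sum>j=1..N. x j ^ k) lam))"
    using evaluate_p_positive[OF p] by blast
  define s :: "nat \<Rightarrow> complex poly poly poly" where "s k = psum_term a [:0, 1:] k + psum_term b [:[:0, 1:]:] k + psum_term c [:[:[:0, 1:]:]:] k"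
    for k
  define Q :: "complex poly poly poly" where
    "Q = (\<Sum>lam\<in>partitions n. [:[:[:of_real (h lam):]:]:] * prod_list (map s lam))"
  have "eval3 P (e1 ^ a) (e2 ^ b) (e3 ^ c) = eval3 Q (e1 ^ a) (e2 ^ b) (e3 ^ c)" for e1 e2 e3
  proof -
    have "eval3 (s k) (e1 ^ a) (e2 ^ b) (e3 ^ c) = (\<Sum>j=1..a + b + c. ?x e1 e2 e3 j ^ k)" for k
      unfolding psum_alphabet3[OF pos] by (simp add: s_def eval3_psum_term)
    then show ?thesis
      unfolding P(1) n evaluate_ribbon_fn[OF ribbon, symmetric] h(2) Q_def
      by (simp only: eval3_sum eval3_simps eval3_prod_list map_map o_def)
  qed
  \<comment> \<open>Letting e1, e2, e3 run through the natural numbers gives an infinite grid of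
    a-th, b-th and c-th powers.\<close>
  moreover have "infinite (range (\<lambda>m. of_nat m ^ k :: complex))" if "k > 0" for k
  proof (rule range_inj_infinite, rule injI)
    fix m m' :: nat
    assume "of_nat m ^ k = (of_nat m' ^ k :: complex)"
    then have "m ^ k = m' ^ k"
      by (metis of_nat_eq_iff of_nat_power)
    then show "m = m'"
      using that by (metis power_eq_imp_eq_base zero_le)
  qed
  ultimately have "P = Q"
    using pos by (intro eval3_eq_imp_eq[of "range (\<lambda>m. of_nat m ^ a)" "range (\<lambda>m. of_nat m ^ b)"
      "range (\<lambda>m. of_nat m ^ c)"]) auto
  have "nonneg_coeffs (s k)" for k
    unfolding s_def
    by (intro nonneg_coeffs_add nonneg_coeffs_psum_term) (simp_all add: nonneg_coeffs_def coeff3_var_power)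
  then have "nonneg_coeffs Q"
    unfolding Q_def
    by (intro nonneg_coeffs_sum nonneg_coeffs_mult nonneg_coeffs_prod_list nonneg_coeffs_const h(1)) auto
  then have "chi3 n (row_ends \<alpha>) a b c \<in> (\<real>\<^sub>\<ge>\<^sub>0 :: complex set)"
    unfolding nonneg_coeffs_def using P(2) \<open>P = Q\<close> by metis
  moreover have "chi3 n (row_ends \<alpha>) a b c = (of_int (chi3 n (row_ends \<alpha>) a b c) :: complex)"
    by (simp add: chi3_def)
  ultimately have "0 \<le> Re (of_int (chi3 n (row_ends \<alpha>) a b c))"
    by (metis complex_nonneg_Reals_iff)
  then show ?thesis
    by simp
qed

section \<open>Descents near the ends of the ribbon\<close>

text \<open>A single column is the transpose of the row \<open>tri n 1\<close>. Excluding it leaves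
  a row with at least two boxes, so that the minima defining head and tail lengths are
  attained.\<close>

lemma replicate_one_in_ribbonB:
  assumes "odd n"
  shows "replicate n 1 \<in> ribbonB"
\<comment> \<open>\<open>ribbonB_n\<close> has a shorter form for n at most 2, which for odd n means
  n = 1.\<close>
proof (cases "n = 1")
  case True
  then have "replicate n 1 = tri 1 1"
    by (simp add: tri_def)
  then have "replicate n 1 \<in> ribbonB_n 1"
    by (simp add: ribbonB_n_def)
  then show ?thesis
    unfolding ribbonB_def by blast
next
  case False
  then have n: "n \<ge> 3"
    using assms by presburger
  have diffs_upt: "diffs i [Suc i..<Suc i + k] = replicate k 1" for i k
  proof (induction k arbitrary: i)
    case (Suc k)
    have "[Suc i..<Suc i + Suc k] = Suc i # [Suc (Suc i)..<Suc (Suc i) + k]"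
      by (simp add: upt_conv_Cons)
    then show ?case
      using Suc[of "Suc i"] by simp
  qed simp
  \<comment> \<open>A row has no descents, so its transpose has all of them and every difference is
    1.\<close>
  have "descents [n] = {}"
    by (auto simp: descents_def)
  moreover have "insert n {1..<n} = set [1..<Suc n]"
    using n by auto
  ultimately have "ribbon_transpose (tri n 1) = rev (diffs 0 [1..<Suc n])"
    using n unfolding ribbon_transpose_def comp_of_set_def tri_def
    by (simp add: sorted_list_of_set.idem_if_sorted_distinct del: upt_Suc set_upt)
  also have "\<dots> = replicate n 1"
    using diffs_upt[of 0 n] by simp
  finally have "replicate n 1 \<in> ribbonB_n n"
    using n by (simp add: ribbonB_n_def)
  then show ?thesis
    using n unfolding ribbonB_def by (intro UN_I[of n]) auto
qed

context
  fixes \<alpha> :: "nat list"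
  assumes ribbon: "is_ribbon \<alpha>"
begin

lemma not_in_row_ends:
  assumes "s < length \<alpha>" "row_end \<alpha> (Suc s) < i" "i < row_end \<alpha> s"
  shows "i \<notin> row_ends \<alpha>"
proof
  assume "i \<in> row_ends \<alpha>"
  then obtain r where r: "1 \<le> r" "r < length \<alpha>" "i = row_end \<alpha> r"
    by (auto simp: row_ends_def)
  have "r \<le> s \<or> Suc s \<le> r"
    by linarith
  then show False
    using row_end_mono[OF ribbon, of r s] row_end_mono[OF ribbon, of "Suc s" r] r assms by auto
qed

text \<open>With k the head length and n the size, the rows above row k hold one box each, so n - 1,
  ..., n - k + 1 start rows. The last box of row k has number n - k and is not the first of its
  row.\<close>

lemma head_row_ends:
  assumes ex: "i < length \<alpha>" "2 \<le> \<alpha> ! i"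
  shows "head_len \<alpha> < sum_list \<alpha>" "sum_list \<alpha> - head_len \<alpha> \<notin> row_ends \<alpha>"
    and "\<And>j. 1 \<le> j \<Longrightarrow> j < head_len \<alpha> \<Longrightarrow> sum_list \<alpha> - j \<in> row_ends \<alpha>"
    and "1 \<le> head_len \<alpha>" "2 \<le> \<alpha> ! (head_len \<alpha> - 1)"
proof -
  let ?P = "\<lambda>i. 1 \<le> i \<and> i \<le> length \<alpha> \<and> 2 \<le> \<alpha> ! (i - 1)"
  have P: "?P (head_len \<alpha>)"
    unfolding head_len_def by (rule LeastI[of ?P "Suc i"]) (use ex in simp)
  then obtain k where k: "head_len \<alpha> = Suc k" "k < length \<alpha>" "2 \<le> \<alpha> ! k"
    by (cases "head_len \<alpha>") auto
  have one: "\<alpha> ! j = 1" if "j < k" for j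
  proof -
    have "\<not> ?P (Suc j)"
      using not_less_Least[of "Suc j" ?P] that k(1) by (simp add: head_len_def)
    then show ?thesis
      using that k row_pos[OF ribbon, of j] by auto
  qed
  have run: "row_end \<alpha> j + j = sum_list \<alpha>" if "j \<le> k" for j
    using that
  proof (induction j)
    case (Suc j)
    then show ?case
      using one[of j] row_end_step[OF ribbon, of j] k by simp
  qed (simp add: row_end_0[OF ribbon])
  have "row_end \<alpha> k \<ge> 2 + row_end \<alpha> (Suc k)"
    using row_end_step[OF ribbon, of k] k by simp
  then have "row_end \<alpha> (Suc k) < sum_list \<alpha> - Suc k" "sum_list \<alpha> - Suc k < row_end \<alpha> k"
    "Suc k < sum_list \<alpha>"
    using run[of k] by linarith+
  then show "head_len \<alpha> < sum_list \<alpha>" "sum_list \<alpha> - head_len \<alpha> \<notin> row_ends \<alpha>"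
    unfolding k(1) using not_in_row_ends[OF k(2)] by blast+
  show "sum_list \<alpha> - j \<in> row_ends \<alpha>" if "1 \<le> j" "j < head_len \<alpha>" for j
    using run[of j] that k by (auto simp: row_ends_def intro!: image_eqI[of _ _ j])
  show "1 \<le> head_len \<alpha>" "2 \<le> \<alpha> ! (head_len \<alpha> - 1)"
    using P by auto
qed

text \<open>The bottom row holds the numbers below \<open>last \<alpha>\<close>, so this is the
  least row end.\<close>

lemma tail_row_ends_last:
  assumes "last \<alpha> > 1" "length \<alpha> > 1"
  shows "tail_len \<alpha> \<in> row_ends \<alpha>" "\<And>j. 1 \<le> j \<Longrightarrow> j < tail_len \<alpha> \<Longrightarrow> j \<notin> row_ends \<alpha>"
    "1 < tail_len \<alpha>"
proof -
  have tl: "tail_len \<alpha> = last \<alpha>"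
    using assms by (simp add: tail_len_def)
  have "\<alpha> \<noteq> []"
    using assms by auto
  then have last: "row_end \<alpha> (length \<alpha> - 1) = last \<alpha>"
    using assms row_end_step[OF ribbon, of "length \<alpha> - 1"] row_end_length[OF ribbon] by (simp add: last_conv_nth)
  then show "tail_len \<alpha> \<in> row_ends \<alpha>"
    using assms unfolding tl row_ends_def by (intro image_eqI[of _ _ "length \<alpha> - 1"]) auto
  have "Suc (length \<alpha> - 1) = length \<alpha>"
    using assms(2) by simp
  then show "j \<notin> row_ends \<alpha>" if "1 \<le> j" "j < tail_len \<alpha>" for j
    using that last tl assms row_end_length[OF ribbon] by (intro not_in_row_ends[of "length \<alpha> - 1"]) auto
  show "1 < tail_len \<alpha>"
    using assms tl by simp
qed

text \<open>The mirror image of \<open>head_row_ends\<close>: with m the tail length, the one-box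
  rows at the bottom give the ends 1, ..., m - 1, and the longer row starting at m - 1 also contains
  m.\<close>

lemma tail_row_ends_one:
  assumes "last \<alpha> = 1" "i < length \<alpha>" "2 \<le> \<alpha> ! i"
  shows "tail_len \<alpha> \<notin> row_ends \<alpha>" "\<And>j. 1 \<le> j \<Longrightarrow> j < tail_len \<alpha> \<Longrightarrow> j \<in> row_ends \<alpha>"
proof -
  let ?P = "\<lambda>j. 1 \<le> j \<and> j \<le> length \<alpha> \<and> 2 \<le> \<alpha> ! (length \<alpha> - j)"
  have tl: "tail_len \<alpha> = (LEAST j. ?P j)"
    using assms by (simp add: tail_len_def)
  have P: "?P (tail_len \<alpha>)"
    unfolding tl by (rule LeastI[of ?P "length \<alpha> - i"]) (use assms in simp)
  have one: "\<alpha> ! (length \<alpha> - j) = 1" if "1 \<le> j" "j < tail_len \<alpha>" for j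
  proof -
    have "\<not> ?P j"
      using not_less_Least[of j ?P] that by (simp add: tl)
    moreover have "length \<alpha> - j < length \<alpha>"
      using that P by linarith
    ultimately show ?thesis
      using that P row_pos[OF ribbon, of "length \<alpha> - j"] by auto
  qed
  have run: "row_end \<alpha> (length \<alpha> - j) = j" if "j < tail_len \<alpha>" for j
    using that
  proof (induction j)
    case (Suc j)
    then have "Suc (length \<alpha> - Suc j) = length \<alpha> - j"
      using P by linarith
    then show ?case
      using Suc one[of "Suc j"] row_end_step[OF ribbon, of "length \<alpha> - Suc j"] P by simp
  qed (simp add: row_end_length[OF ribbon])
  show "j \<in> row_ends \<alpha>" if "1 \<le> j" "j < tail_len \<alpha>" for j
    using run[of j] that P unfolding row_ends_def
    by (intro image_eqI[of _ _ "length \<alpha> - j"]) auto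
  obtain m where m: "tail_len \<alpha> = Suc m"
    using P by (cases "tail_len \<alpha>") auto
  have "Suc (length \<alpha> - Suc m) = length \<alpha> - m"
    using P m by linarith
  then show "tail_len \<alpha> \<notin> row_ends \<alpha>"
    using run[of m] m P row_end_step[OF ribbon, of "length \<alpha> - Suc m"]
    by (intro not_in_row_ends[of "length \<alpha> - Suc m"]) auto
qed

end

section \<open>A negative coefficient in each of the three cases\<close>

theorem mainTheorem17:
  fixes \<alpha> :: "nat list"
  assumes "is_ribbon \<alpha>"
    and "\<alpha> \<notin> ribbonB"
    and "odd (sum_list \<alpha>)"
    and "odd (length \<alpha>)"
    and "\<alpha> ! 0 = 1"
  shows "(last \<alpha> > 1 \<and> even (head_len \<alpha>) \<longrightarrow> \<not> p_positive (ribbon_fn \<alpha>)) \<and>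
         (last \<alpha> > 1 \<and> odd (head_len \<alpha>) \<and> even (tail_len \<alpha>) \<longrightarrow> \<not> p_positive (ribbon_fn \<alpha>)) \<and>
         (last \<alpha> = 1 \<and> head_len \<alpha> = tail_len \<alpha> \<longrightarrow> \<not> p_positive (ribbon_fn \<alpha>))"
proof -
  let ?n = "sum_list \<alpha>" and ?D = "row_ends \<alpha>"
  let ?k = "head_len \<alpha>" and ?m = "tail_len \<alpha>"
  have pos: "0 < x" if "x \<in> set \<alpha>" for x
    using assms(1) that by (simp add: is_ribbon_def)
  obtain i where i: "i < length \<alpha>" "2 \<le> \<alpha> ! i"
  proof (rule ccontr)
    assume "\<not> thesis"
    then have "\<forall>i<length \<alpha>. \<alpha> ! i = 1"
      using that pos by (metis One_nat_def Suc_1 Suc_leI le_neq_implies_less nth_mem)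
    then have "\<alpha> = replicate (length \<alpha>) 1"
      by (auto intro: nth_equalityI)
    then show False
      using replicate_one_in_ribbonB[OF assms(4)] assms(2) by simp
  qed
  note head = head_row_ends[OF assms(1) i]
  have "?k \<noteq> 1"
    using head(5) assms(5) by auto
  then have k2: "2 \<le> ?k"
    using head(4) by linarith
  have n1: "?n - 1 \<in> ?D"
    using head(3)[of 1] k2 by simp
  have bounds: "?D \<subseteq> {0<..<?n}"
    by (rule row_ends_bounds(2)[OF assms(1)])
  \<comment> \<open>The odd number of rows makes the sign in \<open>chi3\<close> positive.\<close>
  have sign: "even (card ?D)"
    using row_ends_bounds(3)[OF assms(1)] assms(4) by simp
  have neg: "\<not> p_positive (ribbon_fn \<alpha>)"
    if "odd a" "odd b" "odd c" "(chi3 ?n ?D a b c :: int) < 0" for a b c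
    using p_positive_imp_chi3_nonneg[OF assms(1) _ that(1-3) refl] that(4) by linarith
  have len: "length \<alpha> > 1" if "last \<alpha> > 1"
  proof (rule ccontr)
    assume "\<not> length \<alpha> > 1"
    then have "length \<alpha> = 1"
      using assms(4) by presburger
    then have "last \<alpha> = \<alpha> ! 0"
      by (cases \<alpha>) auto
    then show False
      using that assms(5) by simp
  qed
  \<comment> \<open>Here n - 1 and n - k + 1 are row ends while 1 and n - k are not. With p and q
    recording whether k - 1 and k are, the value is 8 times (1 - p) (-1 - q) - p, which is negative
    for all p, q in {0, 1}.\<close>
  have a: "\<not> p_positive (ribbon_fn \<alpha>)" if "last \<alpha> > 1" "even ?k"
  proof (rule neg[of 1 "?k - 1" "?n - ?k"])
    note tail = tail_row_ends_last[OF assms(1) that(1) len[OF that(1)]]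
    have "1 \<notin> ?D"
      using tail(2)[of 1] tail(3) by simp
    moreover have "?n - ?k + 1 \<in> ?D" "1 + (?k - 1) = ?k" "?k - 1 + (?n - ?k) = ?n - 1"
      "?n = 1 + (?k - 1) + (?n - ?k)"
      using head(1) head(3)[of "?k - 1"] k2 by (simp_all add: Suc_diff_le)
    ultimately show "(chi3 ?n ?D 1 (?k - 1) (?n - ?k) :: int) < 0"
      unfolding chi3_def using head(2) n1 sign by (simp add: add.commute)
  qed (use that assms(3) k2 head(1) in auto)
  \<comment> \<open>Here n - 1 and m are row ends while 1 and m - 1 are not. With r and s recording
    n - m and n - m + 1, the value is 8 times (1 - r) (-1 - s) - r.\<close>
  have b: "\<not> p_positive (ribbon_fn \<alpha>)" if "last \<alpha> > 1" "even ?m"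
  proof (rule neg[of 1 "?m - 1" "?n - ?m"])
    note tail = tail_row_ends_last[OF assms(1) that(1) len[OF that(1)]]
    have m: "?m < ?n"
      using tail(1) bounds by auto
    have "1 \<notin> ?D" "?m - 1 \<notin> ?D"
      using tail(2)[of 1] tail(2)[of "?m - 1"] tail(3) by simp_all
    moreover have "1 + (?m - 1) = ?m" "?m - 1 + (?n - ?m) = ?n - 1" "?n = 1 + (?m - 1) + (?n - ?m)"
      using m tail(3) by simp_all
    ultimately show "(chi3 ?n ?D 1 (?m - 1) (?n - ?m) :: int) < 0"
      unfolding chi3_def using tail(1) n1 sign by simp
    show "odd (?m - 1)" "odd (?n - ?m)"
      using that assms(3) tail(3) m by auto
  qed simp
  have c: "\<not> p_positive (ribbon_fn \<alpha>)" if "last \<alpha> = 1" "?k = ?m"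
  proof -
    note tail = tail_row_ends_one[OF assms(1) that(1) i, folded that(2)]
    have D1: "1 \<in> ?D" "?k - 1 \<in> ?D" "?k \<notin> ?D"
      using tail k2 by auto
    show ?thesis
    proof (cases "even ?k")
      case True
      show ?thesis
      \<comment> \<open>Now 1, k - 1, n - 1 and n - k + 1 are row ends while k and n - k are not, so
        the value is 8 times (1 - 2) (1 - 2) - 2 = -1.\<close>
      proof (rule neg[of 1 "?k - 1" "?n - ?k"])
        have "?n - ?k + 1 \<in> ?D" "1 + (?k - 1) = ?k" "?k - 1 + (?n - ?k) = ?n - 1"
          "?n = 1 + (?k - 1) + (?n - ?k)"
          using head(1) head(3)[of "?k - 1"] k2 by (simp_all add: Suc_diff_le)
        then show "(chi3 ?n ?D 1 (?k - 1) (?n - ?k) :: int) < 0"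
          unfolding chi3_def using D1 head(2) n1 sign by (simp add: add.commute)
      qed (use True assms(3) k2 head(1) in auto)
    next
      case False
      \<comment> \<open>Both k and n are odd, so k < n leaves a gap of at least 2 and the third part
        is positive.\<close>
      then have nk: "?k + 1 < ?n"
        using head(1) assms(3) by presburger
      show ?thesis
      \<comment> \<open>Now 1 and n - 1 are row ends while k and n - k are not. With r and s
        recording n - k - 1 and k + 1, the value is 8 times r s - (1 + r s) = -1.\<close>
      proof (rule neg[of 1 "?k" "?n - ?k - 1"])
        have "1 + (?n - ?k - 1) = ?n - ?k" "?k + (?n - ?k - 1) = ?n - 1" "?n = 1 + ?k + (?n - ?k - 1)"
          using nk by simp_all
        then show "(chi3 ?n ?D 1 ?k (?n - ?k - 1) :: int) < 0"
          unfolding chi3_def using D1 head(2) n1 sign by simp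
        show "odd (?n - ?k - 1)"
          using nk assms(3) False by simp
      qed (use False in auto)
    qed
  qed
  show ?thesis
    using a b c by blast
qed

end
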